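(* There exists a metric surface $X$ of locally finite Hausdorff $2$-measure and a non-degenerate continuum $E\subset X$ such that for every point $a\in E$ the condition $$\lim_{r\to0}\operatorname{mod}\Gamma(\overline B(a,r),X\setminus B(a,R);X)=0\quad\text{for each }R>0$$ fails.
   Context: A metric surface is a metric space homeomorphic to a $2$-manifold, possibly with non-empty boundary. A non-degenerate continuum is a compact connected set with more than one point. $\mathcal H^2$ is the Hausdorff $2$-measure, normalized to agree with Lebesgue measure on $\mathbb R^2$. For a family $\Gamma$ of curves in a metric space $X$, the ($2$-)modulus is $\operatorname{mod}\Gamma=\inf_\rho\int_X\rho^2\,d\mathcal H^2$, where the infimum is over all Borel functions $\rho\colon X\to[0,\infty]$ with $\int_\gamma\rho\,ds\ge1$ for all locally rectifiable $\gamma\in\Gamma$ (and $\operatorname{mod}\Gamma=\infty$ if there is no such $\rho$). For $G\subset X$ and disjoint $E,F\subset G$, $\Gamma(E,F;G)$ is the family of curves in $G$ joining $E$ and $F$. $B(a,r)$ and $\overline B(a,r)$ are open and closed metric balls. *)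

theory Defs
  imports "HOL-Analysis.Analysis"
begin

section \<open>Metric surfaces\<close>

definition two_manifold_with_boundary :: "'a topology \<Rightarrow> bool" where
  "two_manifold_with_boundary T \<longleftrightarrow>
     Hausdorff_space T \<and> second_countable T \<and>
     (\<forall>x\<in>topspace T. \<exists>U V. openin T U \<and> x \<in> U \<and>
        openin (top_of_set {p::real \<times> real. 0 \<le> snd p}) V \<and>
        subtopology T U homeomorphic_space top_of_set V)"

definition metric_surface :: "'a metric \<Rightarrow> bool" where
  "metric_surface X \<longleftrightarrow> two_manifold_with_boundary (mtopology_of X)"

definition nondegenerate_continuum :: "'a metric \<Rightarrow> 'a set \<Rightarrow> bool" where
  "nondegenerate_continuum X E \<longleftrightarrow>
     compactin (mtopology_of X) E \<and> connectedin (mtopology_of X) E \<and>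
     (\<exists>x\<in>E. \<exists>y\<in>E. x \<noteq> y)"


section \<open>Hausdorff 2-measure\<close>

definition ediam :: "'a metric \<Rightarrow> 'a set \<Rightarrow> ennreal" where
  "ediam X A = (SUP (x, y)\<in>A \<times> A. ennreal (mdist X x y))"

definition hausdorff2_pre :: "'a metric \<Rightarrow> real \<Rightarrow> 'a set \<Rightarrow> ennreal" where
  "hausdorff2_pre X \<delta> S =
     (INF A\<in>{A :: nat \<Rightarrow> 'a set. S \<subseteq> (\<Union>i. A i) \<and> (\<forall>i. A i \<subseteq> mspace X \<and> ediam X (A i) \<le> ennreal \<delta>)}.
        \<Sum>i. ennreal (pi / 4) * (ediam X (A i))\<^sup>2)"

text \<open>The factor \<open>pi / 4\<close>, the area of a disc of diameter 1, makes this agree with Lebesgue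
  measure in the Euclidean plane.\<close>

definition hausdorff2_outer :: "'a metric \<Rightarrow> 'a set \<Rightarrow> ennreal" where
  "hausdorff2_outer X S = (SUP \<delta>\<in>{0<..}. hausdorff2_pre X \<delta> S)"

definition hausdorff2 :: "'a metric \<Rightarrow> 'a measure" where
  "hausdorff2 X = measure_of (mspace X) {U. openin (mtopology_of X) U} (hausdorff2_outer X)"

definition locally_finite_hausdorff2 :: "'a metric \<Rightarrow> bool" where
  "locally_finite_hausdorff2 X \<longleftrightarrow>
     (\<forall>x\<in>mspace X. \<exists>U. openin (mtopology_of X) U \<and> x \<in> U \<and> emeasure (hausdorff2 X) U < \<infinity>)"

text \<open>Since \<^const>\<open>measure_of\<close> returns the zero measure when its argument is not
  countably additive, we check that \<open>hausdorff2\<close> does extend the outer measure to a measure on the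
  Borel sets (theorem \<open>emeasure_hausdorff2\<close> below).\<close>

lemma ediam_mono: "A \<subseteq> B \<Longrightarrow> ediam X A \<le> ediam X B"
  unfolding ediam_def by (rule SUP_subset_mono) auto

lemma ediam_empty [simp]: "ediam X {} = 0"
  by (simp add: ediam_def bot_ennreal)

lemma ediam_upper: "x \<in> A \<Longrightarrow> y \<in> A \<Longrightarrow> ennreal (mdist X x y) \<le> ediam X A"
  unfolding ediam_def by (rule SUP_upper2[of "(x, y)"]) auto

lemma hausdorff2_pre_mono: "S \<subseteq> T \<Longrightarrow> hausdorff2_pre X \<delta> S \<le> hausdorff2_pre X \<delta> T"
  unfolding hausdorff2_pre_def by (rule INF_superset_mono) auto

lemma hausdorff2_pre_antimono:
  "\<delta> \<le> \<epsilon> \<Longrightarrow> hausdorff2_pre X \<epsilon> S \<le> hausdorff2_pre X \<delta> S"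
  unfolding hausdorff2_pre_def
  by (rule INF_superset_mono) (auto intro: order_trans ennreal_leI)

lemma hausdorff2_pre_empty [simp]: "hausdorff2_pre X \<delta> {} = 0"
proof -
  have "hausdorff2_pre X \<delta> {} \<le> (\<Sum>i::nat. ennreal (pi / 4) * (ediam X {})\<^sup>2)"
    unfolding hausdorff2_pre_def by (rule INF_lower2[of "\<lambda>_. {}"]) auto
  then show ?thesis by simp
qed

lemma hausdorff2_pre_countably_subadditive:
  "hausdorff2_pre X \<delta> (\<Union>n::nat. S n) \<le> (\<Sum>n. hausdorff2_pre X \<delta> (S n))"
proof (rule ennreal_le_epsilon)
  fix e :: real assume fin: "(\<Sum>n. hausdorff2_pre X \<delta> (S n)) < top" and e: "0 < e"
  let ?v = "\<lambda>B. ennreal (pi / 4) * (ediam X B)\<^sup>2"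
  let ?C = "\<lambda>S. {A :: nat \<Rightarrow> _. S \<subseteq> (\<Union>i. A i) \<and> (\<forall>i. A i \<subseteq> mspace X \<and> ediam X (A i) \<le> ennreal \<delta>)}"
  have "\<exists>A\<in>?C (S n). (\<Sum>i. ?v (A i)) \<le> hausdorff2_pre X \<delta> (S n) + ennreal (e * (1/2)^Suc n)" for n
  proof -
    have "hausdorff2_pre X \<delta> (S n) < top"
      using fin ennreal_suminf_lessD by blast
    then have "hausdorff2_pre X \<delta> (S n) < hausdorff2_pre X \<delta> (S n) + ennreal (e * (1/2)^Suc n)"
      using e by simp
    then show ?thesis
      unfolding hausdorff2_pre_def by (subst (asm) INF_less_iff) (auto intro: less_imp_le)
  qed
  then have "\<forall>n. \<exists>A. A \<in> ?C (S n) \<and>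
      (\<Sum>i. ?v (A i)) \<le> hausdorff2_pre X \<delta> (S n) + ennreal (e * (1/2)^Suc n)"
    by (auto simp only: Bex_def)
  from choice[OF this] obtain A where AA: "\<forall>n. A n \<in> ?C (S n) \<and>
      (\<Sum>i. ?v (A n i)) \<le> hausdorff2_pre X \<delta> (S n) + ennreal (e * (1/2)^Suc n)" ..
  have A: "A n \<in> ?C (S n)" for n by (rule AA[THEN spec, THEN conjunct1])
  have le: "(\<Sum>i. ?v (A n i)) \<le> hausdorff2_pre X \<delta> (S n) + ennreal (e * (1/2)^Suc n)" for n
    by (rule AA[THEN spec, THEN conjunct2])
  define B where "B k = (case prod_decode k of (n, i) \<Rightarrow> A n i)" for k
  have "B \<in> ?C (\<Union>n. S n)"
  proof -
    have "x \<in> (\<Union>k. B k)" if "x \<in> S n" for x n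
    proof -
      obtain i where "x \<in> A n i" using A[of n] \<open>x \<in> S n\<close> by blast
      then have "x \<in> B (prod_encode (n, i))" by (simp add: B_def)
      then show ?thesis by blast
    qed
    moreover have "B k \<subseteq> mspace X \<and> ediam X (B k) \<le> ennreal \<delta>" for k
      using A by (auto simp: B_def split: prod.split)
    ultimately show ?thesis by blast
  qed
  then have "hausdorff2_pre X \<delta> (\<Union>n. S n) \<le> (\<Sum>k. ?v (B k))"
    unfolding hausdorff2_pre_def by (rule INF_lower)
  also have "\<dots> = (\<Sum>n. \<Sum>i. ?v (A n i))"
  proof -
    have "(\<Sum>k. (\<lambda>(n, i). ?v (A n i)) (prod_decode k)) = (\<Sum>n. \<Sum>i. ?v (A n i))"
      by (rule suminf_ennreal_2dimen) simp
    moreover have "(\<lambda>(n, i). ?v (A n i)) (prod_decode k) = ?v (B k)" for k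
      by (simp add: B_def split: prod.split)
    ultimately show ?thesis by simp
  qed
  also have "\<dots> \<le> (\<Sum>n. hausdorff2_pre X \<delta> (S n) + ennreal (e * (1/2)^Suc n))"
    by (intro suminf_le le) auto
  also have "\<dots> = (\<Sum>n. hausdorff2_pre X \<delta> (S n)) + (\<Sum>n. ennreal (e * (1/2)^Suc n))"
    by (rule suminf_add[symmetric]) auto
  also have "(\<Sum>n. ennreal (e * (1/2)^Suc n)) = ennreal e"
  proof (rule suminf_ennreal_eq)
    show "(\<lambda>n. e * (1/2)^Suc n) sums e"
      using sums_mult[OF power_half_series, of e] by simp
  qed (use e in simp)
  finally show "hausdorff2_pre X \<delta> (\<Union>n. S n) \<le> (\<Sum>n. hausdorff2_pre X \<delta> (S n)) + ennreal e" .
qed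

lemma hausdorff2_outer_mono: "S \<subseteq> T \<Longrightarrow> hausdorff2_outer X S \<le> hausdorff2_outer X T"
  unfolding hausdorff2_outer_def by (intro SUP_mono' hausdorff2_pre_mono)

lemma hausdorff2_outer_empty [simp]: "hausdorff2_outer X {} = 0"
  unfolding hausdorff2_outer_def by simp

lemma hausdorff2_outer_countably_subadditive:
  "hausdorff2_outer X (\<Union>n::nat. S n) \<le> (\<Sum>n. hausdorff2_outer X (S n))"
  unfolding hausdorff2_outer_def
  by (rule SUP_least, rule order_trans[OF hausdorff2_pre_countably_subadditive])
     (auto intro!: suminf_le SUP_upper)

lemma hausdorff2_outer_subadditive:
  "hausdorff2_outer X (S \<union> T) \<le> hausdorff2_outer X S + hausdorff2_outer X T"
proof -
  have "(\<Union>n. binaryset S T n) = S \<union> T" by (rule UN_binaryset_eq)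
  moreover have "(\<Sum>n. hausdorff2_outer X (binaryset S T n))
      = hausdorff2_outer X S + hausdorff2_outer X T"
    by (rule suminf_binaryset_eq) simp
  ultimately show ?thesis
    using hausdorff2_outer_countably_subadditive[of X "binaryset S T"] by simp
qed

lemma hausdorff2_outer_separated:
  assumes "0 < \<epsilon>" and sep: "\<And>x y. x \<in> S \<Longrightarrow> y \<in> T \<Longrightarrow> \<epsilon> \<le> mdist X x y"
  shows "hausdorff2_outer X S + hausdorff2_outer X T \<le> hausdorff2_outer X (S \<union> T)"
proof -
  let ?v = "\<lambda>B. ennreal (pi / 4) * (ediam X B)\<^sup>2"
  have small: "hausdorff2_pre X \<delta> S + hausdorff2_pre X \<delta> T \<le> hausdorff2_pre X \<delta> (S \<union> T)"
    if "\<delta> < \<epsilon>" "0 < \<delta>" for \<delta>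
    unfolding hausdorff2_pre_def[of _ _ "S \<union> T"]
  proof (rule INF_greatest)
    fix A
    assume "A \<in> {A :: nat \<Rightarrow> _. S \<union> T \<subseteq> (\<Union>i. A i) \<and>
      (\<forall>i. A i \<subseteq> mspace X \<and> ediam X (A i) \<le> ennreal \<delta>)}"
    then have S: "S \<subseteq> (\<Union>i. A i)" and T: "T \<subseteq> (\<Union>i. A i)"
      and A: "\<forall>i. A i \<subseteq> mspace X \<and> ediam X (A i) \<le> ennreal \<delta>"
      by auto
    have disj: "A i \<inter> S = {} \<or> A i \<inter> T = {}" for i
    proof (rule ccontr)
      assume "\<not> ?thesis"
      then obtain x y where "x \<in> A i" "x \<in> S" "y \<in> A i" "y \<in> T" by blast
      then have "ennreal \<epsilon> \<le> ediam X (A i)"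
        using sep[of x y] ediam_upper[of x "A i" y X] by (meson ennreal_leI order_trans)
      then have "ennreal \<epsilon> \<le> ennreal \<delta>" using A order_trans by blast
      then show False using that by (simp add: ennreal_le_iff)
    qed
    have "hausdorff2_pre X \<delta> S \<le> (\<Sum>i. ?v (A i \<inter> S))"
      unfolding hausdorff2_pre_def using S A
      by (intro INF_lower2[of "\<lambda>i. A i \<inter> S"])
         (auto intro: order_trans[OF ediam_mono[of "_ \<inter> S"]])
    moreover have "hausdorff2_pre X \<delta> T \<le> (\<Sum>i. ?v (A i \<inter> T))"
      unfolding hausdorff2_pre_def using T A
      by (intro INF_lower2[of "\<lambda>i. A i \<inter> T"])
         (auto intro: order_trans[OF ediam_mono[of "_ \<inter> T"]])
    ultimately have "hausdorff2_pre X \<delta> S + hausdorff2_pre X \<delta> T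
        \<le> (\<Sum>i. ?v (A i \<inter> S)) + (\<Sum>i. ?v (A i \<inter> T))"
      by (rule add_mono)
    also have "\<dots> = (\<Sum>i. ?v (A i \<inter> S) + ?v (A i \<inter> T))"
      by (rule suminf_add) auto
    also have "\<dots> \<le> (\<Sum>i. ?v (A i))"
    proof (rule suminf_le)
      fix i
      have "?v (A i \<inter> S) \<le> ?v (A i)" "?v (A i \<inter> T) \<le> ?v (A i)"
        by (intro mult_left_mono power_mono ediam_mono; auto)+
      then show "?v (A i \<inter> S) + ?v (A i \<inter> T) \<le> ?v (A i)"
        using disj[of i] by auto
    qed auto
    finally show "hausdorff2_pre X \<delta> S + hausdorff2_pre X \<delta> T \<le> (\<Sum>i. ?v (A i))" .
  qed
  have "hausdorff2_outer X S + hausdorff2_outer X T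
      = (SUP \<delta>\<in>{0<..}. hausdorff2_pre X \<delta> S + hausdorff2_pre X \<delta> T)"
    unfolding hausdorff2_outer_def
  proof (rule SUP_add_directed_ennreal[symmetric])
    fix \<delta> \<delta>' :: real assume "\<delta> \<in> {0<..}" "\<delta>' \<in> {0<..}"
    then show "\<exists>k\<in>{0<..}. hausdorff2_pre X \<delta> S + hausdorff2_pre X \<delta>' T
        \<le> hausdorff2_pre X k S + hausdorff2_pre X k T"
      by (intro bexI[of _ "min \<delta> \<delta>'"] add_mono hausdorff2_pre_antimono) auto
  qed
  also have "\<dots> \<le> hausdorff2_outer X (S \<union> T)"
  proof (rule SUP_least)
    fix \<delta> :: real assume "\<delta> \<in> {0<..}"
    then have "hausdorff2_pre X \<delta> S + hausdorff2_pre X \<delta> T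
        \<le> hausdorff2_pre X (min \<delta> (\<epsilon>/2)) S + hausdorff2_pre X (min \<delta> (\<epsilon>/2)) T"
      by (intro add_mono hausdorff2_pre_antimono) auto
    also have "\<dots> \<le> hausdorff2_pre X (min \<delta> (\<epsilon>/2)) (S \<union> T)"
      by (rule small) (use \<open>\<delta> \<in> {0<..}\<close> \<open>0 < \<epsilon>\<close> in auto)
    also have "\<dots> \<le> hausdorff2_outer X (S \<union> T)"
      unfolding hausdorff2_outer_def
      by (rule SUP_upper) (use \<open>\<delta> \<in> {0<..}\<close> \<open>0 < \<epsilon>\<close> in auto)
    finally show "hausdorff2_pre X \<delta> S + hausdorff2_pre X \<delta> T \<le> hausdorff2_outer X (S \<union> T)" .
  qed
  finally show ?thesis .
qed

lemma closedin_caratheodory_hausdorff2: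
  assumes F: "closedin (mtopology_of X) F" and A: "A \<subseteq> mspace X"
  shows "hausdorff2_outer X (A \<inter> F) + hausdorff2_outer X (A - F) = hausdorff2_outer X A"
proof (rule antisym)
  let ?\<mu> = "hausdorff2_outer X"
  interpret Metric_space "mspace X" "mdist X" by simp
  have FM: "F \<subseteq> mspace X" using closedin_subset[OF F] by simp
  show "?\<mu> A \<le> ?\<mu> (A \<inter> F) + ?\<mu> (A - F)"
    using hausdorff2_outer_subadditive[of X "A \<inter> F" "A - F"] by (simp add: Int_Diff_Un)
  show "?\<mu> (A \<inter> F) + ?\<mu> (A - F) \<le> ?\<mu> A"
  proof (cases "?\<mu> A = top")
    case False
    define G where "G n = {x\<in>A. \<forall>z\<in>F. 1 / real (Suc n) \<le> mdist X x z}" for n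
    define D where "D n = G (Suc n) - G n" for n
    have inc: "1 / real (Suc k) \<le> 1 / real (Suc j)" if "j \<le> k" for j k
      using that by (simp add: frac_le)
    have G_mono: "G j \<subseteq> G k" if "j \<le> k" for j k
      unfolding G_def using inc[OF that] by fastforce
    have D_sep: "1 / real (Suc (Suc j)) - 1 / real (Suc (Suc (Suc j))) \<le> mdist X x y"
      if x: "x \<in> G (Suc j)" and y: "y \<in> D k" and "Suc (Suc j) \<le> k" for j k x y
    proof -
      obtain z where z: "z \<in> F" "mdist X y z < 1 / real (Suc k)"
        using y unfolding D_def G_def by force
      have "1 / real (Suc (Suc j)) \<le> mdist X x z" using x z by (auto simp: G_def)
      moreover have "mdist X x z \<le> mdist X x y + mdist X y z"
        using x y z A FM by (intro triangle) (auto simp: G_def D_def)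
      ultimately show ?thesis using z(2) inc[OF \<open>Suc (Suc j) \<le> k\<close>] by linarith
    qed
    have gap: "0 < 1 / real (Suc (Suc j)) - 1 / real (Suc (Suc (Suc j)))" for j
      by (simp add: frac_less2)
    have alt: "(\<Sum>i<n. ?\<mu> (D (2 * i + p))) \<le> ?\<mu> (\<Union>i<n. D (2 * i + p))" for n p
    proof (induction n)
      case (Suc n)
      show ?case
      proof (cases "n = 0")
        case True
        then show ?thesis by (simp add: lessThan_Suc)
      next
        case False
        let ?j = "2 * (n - 1) + p"
        have "(\<Union>i<n. D (2 * i + p)) \<subseteq> G (Suc ?j)"
        proof
          fix x assume "x \<in> (\<Union>i<n. D (2 * i + p))"
          then obtain i where "i < n" "x \<in> G (Suc (2 * i + p))" by (auto simp: D_def)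
          moreover from \<open>i < n\<close> have "Suc (2 * i + p) \<le> Suc ?j" by linarith
          ultimately show "x \<in> G (Suc ?j)" using G_mono by blast
        qed
        then have "?\<mu> (\<Union>i<n. D (2 * i + p)) + ?\<mu> (D (2 * n + p))
            \<le> ?\<mu> ((\<Union>i<n. D (2 * i + p)) \<union> D (2 * n + p))"
          using False by (intro hausdorff2_outer_separated[OF gap[of ?j]] D_sep) auto
        moreover have "(\<Union>i<Suc n. D (2 * i + p)) = (\<Union>i<n. D (2 * i + p)) \<union> D (2 * n + p)"
          by (auto simp: less_Suc_eq)
        ultimately have "?\<mu> (\<Union>i<n. D (2 * i + p)) + ?\<mu> (D (2 * n + p)) \<le> ?\<mu> (\<Union>i<Suc n. D (2 * i + p))"
          by (simp only:)
        then show ?thesis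
          unfolding sum.lessThan_Suc by (rule order_trans[OF add_right_mono[OF Suc.IH]])
      qed
    qed simp
    have alt_le: "(\<Sum>i. ?\<mu> (D (2 * i + p))) \<le> ?\<mu> A" for p
    proof (rule suminf_le_const)
      show "(\<Sum>i<n. ?\<mu> (D (2 * i + p))) \<le> ?\<mu> A" for n
        by (rule order_trans[OF alt hausdorff2_outer_mono]) (auto simp: D_def G_def)
    qed simp
    have sum_D: "(\<Sum>i. ?\<mu> (D i)) \<noteq> top"
    proof -
      have "(\<Sum>i<n. ?\<mu> (D i)) \<le> ?\<mu> A + ?\<mu> A" for n
      proof -
        have "(\<Sum>i<n. ?\<mu> (D i)) \<le> (\<Sum>i<2 * n. ?\<mu> (D i))"
          by (rule sum_mono2) auto
        also have "\<dots> = (\<Sum>i<n. ?\<mu> (D (2 * i + 0))) + (\<Sum>i<n. ?\<mu> (D (2 * i + 1)))"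
          by (induction n) (simp_all add: algebra_simps)
        also have "\<dots> \<le> (\<Sum>i. ?\<mu> (D (2 * i + 0))) + (\<Sum>i. ?\<mu> (D (2 * i + 1)))"
          by (intro add_mono sum_le_suminf) auto
        also have "\<dots> \<le> ?\<mu> A + ?\<mu> A" by (intro add_mono alt_le)
        finally show ?thesis .
      qed
      then have "(\<Sum>i. ?\<mu> (D i)) \<le> ?\<mu> A + ?\<mu> A" by (intro suminf_le_const) auto
      also have "\<dots> < top" using False by (simp add: less_top)
      finally show ?thesis by simp
    qed
    have step: "?\<mu> (A \<inter> F) + ?\<mu> (A - F) \<le> ?\<mu> A + (\<Sum>i. ?\<mu> (D (i + n)))" for n
    proof -
      have "A - F \<subseteq> G n \<union> (\<Union>i. D (i + n))"
      proof
        fix x assume x: "x \<in> A - F"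
        have "openin mtopology (mspace X - F)" using F by (simp add: closedin_def mtopology_of_def)
        then obtain r where r: "0 < r" "mball x r \<subseteq> mspace X - F"
          using x A by (auto simp: openin_mtopology)
        obtain m where m: "1 / real (Suc m) < r" using r(1) nat_approx_posE by blast
        have "x \<in> G m"
        proof -
          have "1 / real (Suc m) \<le> mdist X x z" if "z \<in> F" for z
            using r(2) that m x A FM by (force simp: in_mball)
          then show ?thesis using x by (simp add: G_def)
        qed
        then have ex: "\<exists>m. x \<in> G m" ..
        show "x \<in> G n \<union> (\<Union>i. D (i + n))"
        proof (cases "x \<in> G n")
          case False
          define l where "l = (LEAST m. x \<in> G m)"
          have l: "x \<in> G l" unfolding l_def using ex by (rule LeastI_ex)
          then have "n < l" using False G_mono[of l n] by (meson in_mono not_le_imp_less)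
          then have "x \<notin> G (l - 1)" using not_less_Least[of "l - 1" "\<lambda>m. x \<in> G m"] by (simp add: l_def)
          then have "x \<in> D (l - 1)" using l \<open>n < l\<close> by (simp add: D_def)
          then have "x \<in> D ((l - 1 - n) + n)" using \<open>n < l\<close> by simp
          then show ?thesis by blast
        qed simp
      qed
      then have "?\<mu> (A - F) \<le> ?\<mu> (G n) + ?\<mu> (\<Union>i. D (i + n))"
        using hausdorff2_outer_mono hausdorff2_outer_subadditive order_trans by blast
      also have "\<dots> \<le> ?\<mu> (G n) + (\<Sum>i. ?\<mu> (D (i + n)))"
        by (intro add_left_mono hausdorff2_outer_countably_subadditive)
      finally have "?\<mu> (A \<inter> F) + ?\<mu> (A - F) \<le> (?\<mu> (A \<inter> F) + ?\<mu> (G n)) + (\<Sum>i. ?\<mu> (D (i + n)))"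
        by (metis add.assoc add_left_mono)
      also have "?\<mu> (A \<inter> F) + ?\<mu> (G n) \<le> ?\<mu> (A \<inter> F \<union> G n)"
      proof (rule hausdorff2_outer_separated[of "1 / real (Suc n)"])
        fix x y assume "x \<in> A \<inter> F" "y \<in> G n"
        then show "1 / real (Suc n) \<le> mdist X x y" by (auto simp: G_def commute[of x y])
      qed simp
      also have "\<dots> \<le> ?\<mu> A" by (rule hausdorff2_outer_mono) (auto simp: G_def)
      finally show ?thesis by (simp add: add_right_mono)
    qed
    have "(\<lambda>n. \<Sum>i. ?\<mu> (D (i + n))) \<longlonglongrightarrow> 0"
    proof -
      define f where "f i = enn2real (?\<mu> (D i))" for i
      have Di: "?\<mu> (D i) = ennreal (f i)" for i
        using ennreal_suminf_lessD[of "\<lambda>i. ?\<mu> (D i)" top i] sum_D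
        by (simp add: f_def less_top)
      have f0: "0 \<le> f i" for i by (simp add: f_def)
      have sf: "summable f"
        using sum_D by (intro summable_suminf_not_top) (auto simp: Di f0)
      have "(\<Sum>i. ?\<mu> (D (i + n))) = ennreal (\<Sum>i. f (i + n))" for n
        unfolding Di by (rule suminf_ennreal2) (auto simp: f0 sf summable_iff_shift)
      moreover have "(\<lambda>n. ennreal (\<Sum>i. f (i + n))) \<longlonglongrightarrow> ennreal 0"
        by (intro tendsto_ennrealI suminf_exist_split2 sf)
      ultimately show ?thesis by simp
    qed
    then have "(\<lambda>n. ?\<mu> A + (\<Sum>i. ?\<mu> (D (i + n)))) \<longlonglongrightarrow> ?\<mu> A + 0"
      by (intro tendsto_add tendsto_const)
    then show ?thesis using step by (intro LIMSEQ_le_const) auto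
  qed simp
qed

lemma openin_mtopology_of_Pow: "{U. openin (mtopology_of X) U} \<subseteq> Pow (mspace X)"
  using openin_subset[of "mtopology_of X"] by auto

lemma space_hausdorff2 [simp]: "space (hausdorff2 X) = mspace X"
  unfolding hausdorff2_def by (rule space_measure_of) (rule openin_mtopology_of_Pow)

lemma sets_hausdorff2: "sets (hausdorff2 X) = sigma_sets (mspace X) {U. openin (mtopology_of X) U}"
  unfolding hausdorff2_def by (rule sets_measure_of) (rule openin_mtopology_of_Pow)

theorem emeasure_hausdorff2:
  assumes "S \<in> sets (hausdorff2 X)"
  shows "emeasure (hausdorff2 X) S = hausdorff2_outer X S"
proof -
  let ?M = "mspace X" and ?\<mu> = "hausdorff2_outer X"
  let ?L = "lambda_system ?M (Pow ?M) ?\<mu>"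
  interpret P: sigma_algebra ?M "Pow ?M" by (rule sigma_algebra_Pow)
  have pos: "positive (Pow ?M) ?\<mu>" by (simp add: positive_def)
  have oms: "outer_measure_space (Pow ?M) ?\<mu>"
    using hausdorff2_outer_mono hausdorff2_outer_countably_subadditive
    by (auto simp: outer_measure_space_def increasing_def countably_subadditive_def positive_def)
  interpret L: sigma_algebra ?M ?L
    using P.caratheodory_lemma[OF oms] by (simp add: measure_space_def)
  have "U \<in> ?L" if U: "openin (mtopology_of X) U" for U
  proof -
    have UM: "U \<subseteq> ?M" using openin_subset[OF U] by simp
    have "closedin (mtopology_of X) (?M - U)" using U by (metis openin_closedin_eq topspace_mtopology_of)
    then have "?M - U \<in> ?L"
      unfolding P.lambda_system_eq by (auto simp: closedin_caratheodory_hausdorff2)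
    then have "?M - (?M - U) \<in> ?L" by (rule L.compl_sets)
    then show ?thesis using UM by (simp add: double_diff)
  qed
  then have sub: "sigma_sets ?M {U. openin (mtopology_of X) U} \<subseteq> ?L"
    by (intro L.sigma_sets_subset) auto
  have "emeasure (measure_of ?M {U. openin (mtopology_of X) U} ?\<mu>) S = ?\<mu> S"
  proof (rule emeasure_measure_of)
    show "countably_additive (sets (measure_of ?M {U. openin (mtopology_of X) U} ?\<mu>)) ?\<mu>"
    proof (rule countably_additiveI)
      fix B :: "nat \<Rightarrow> _"
      assume B: "range B \<subseteq> sets (measure_of ?M {U. openin (mtopology_of X) U} ?\<mu>)" "disjoint_family B"
      then have "range B \<subseteq> ?L" using sub sets_hausdorff2[of X] unfolding hausdorff2_def by blast
      then show "(\<Sum>i. ?\<mu> (B i)) = ?\<mu> (\<Union>i. B i)"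
        using P.lambda_system_caratheodory[OF oms] B(2) by blast
    qed
  qed (use assms openin_mtopology_of_Pow in \<open>auto simp: positive_def hausdorff2_def\<close>)
  then show ?thesis by (simp add: hausdorff2_def)
qed


section \<open>Curves and line integrals\<close>

text \<open>A curve is a continuous map from an interval (not necessarily compact), represented by the
  pair of the interval and the map; values outside the interval are irrelevant.\<close>

type_synonym 'a curve = "real set \<times> (real \<Rightarrow> 'a)"

definition is_curve :: "'a metric \<Rightarrow> 'a curve \<Rightarrow> bool" where
  "is_curve X = (\<lambda>(I, \<gamma>). is_interval I \<and> I \<noteq> {} \<and> continuous_map (top_of_set I) (mtopology_of X) \<gamma>)"

definition curve_length :: "'a metric \<Rightarrow> (real \<Rightarrow> 'a) \<Rightarrow> real \<Rightarrow> real \<Rightarrow> ennreal" where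
  "curve_length X \<gamma> a b =
     (SUP (n, t)\<in>{(n::nat, t::nat \<Rightarrow> real). mono_on {..n} t \<and> t ` {..n} \<subseteq> {a..b}}.
        \<Sum>i<n. ennreal (mdist X (\<gamma> (t i)) (\<gamma> (t (Suc i)))))"

definition locally_rectifiable :: "'a metric \<Rightarrow> 'a curve \<Rightarrow> bool" where
  "locally_rectifiable X = (\<lambda>(I, \<gamma>). \<forall>a b. a \<le> b \<longrightarrow> {a..b} \<subseteq> I \<longrightarrow> curve_length X \<gamma> a b < \<infinity>)"

text \<open>The point of a rectifiable curve \<open>\<gamma>\<close> on \<open>[a,b]\<close> at arc length \<open>s\<close> from \<open>\<gamma> a\<close>. The
  choice of parameter is immaterial: \<open>\<gamma>\<close> is constant on the level sets of its arc length.\<close>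

definition arclength_param :: "'a metric \<Rightarrow> (real \<Rightarrow> 'a) \<Rightarrow> real \<Rightarrow> real \<Rightarrow> real \<Rightarrow> 'a" where
  "arclength_param X \<gamma> a b s = \<gamma> (SOME t. t \<in> {a..b} \<and> curve_length X \<gamma> a t = ennreal s)"

definition compact_line_integral ::
    "'a metric \<Rightarrow> ('a \<Rightarrow> ennreal) \<Rightarrow> (real \<Rightarrow> 'a) \<Rightarrow> real \<Rightarrow> real \<Rightarrow> ennreal" where
  "compact_line_integral X \<rho> \<gamma> a b =
     (\<integral>\<^sup>+ s\<in>{0..enn2real (curve_length X \<gamma> a b)}. \<rho> (arclength_param X \<gamma> a b s) \<partial>lborel)"

text \<open>For a locally rectifiable curve, the supremum of the integrals over compact subcurves.\<close>

definition line_integral :: "'a metric \<Rightarrow> ('a \<Rightarrow> ennreal) \<Rightarrow> 'a curve \<Rightarrow> ennreal" where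
  "line_integral X \<rho> =
     (\<lambda>(I, \<gamma>). SUP (a, b)\<in>{(a, b). a \<le> b \<and> {a..b} \<subseteq> I}. compact_line_integral X \<rho> \<gamma> a b)"


section \<open>Modulus\<close>

definition admissible :: "'a metric \<Rightarrow> 'a curve set \<Rightarrow> ('a \<Rightarrow> ennreal) \<Rightarrow> bool" where
  "admissible X \<Gamma> \<rho> \<longleftrightarrow> \<rho> \<in> borel_measurable (hausdorff2 X) \<and>
     (\<forall>c\<in>\<Gamma>. locally_rectifiable X c \<longrightarrow> 1 \<le> line_integral X \<rho> c)"

text \<open>The infimum of the empty set in \<^typ>\<open>ennreal\<close> is infinity, as the convention requires.\<close>

definition modulus :: "'a metric \<Rightarrow> 'a curve set \<Rightarrow> ennreal" where
  "modulus X \<Gamma> = (INF \<rho>\<in>{\<rho>. admissible X \<Gamma> \<rho>}. \<integral>\<^sup>+ x. (\<rho> x)\<^sup>2 \<partial>hausdorff2 X)"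

text \<open>A curve joins two sets if it is defined on a compact interval and has one endpoint in each;
  the orientation is irrelevant.\<close>

definition curves_joining :: "'a metric \<Rightarrow> 'a set \<Rightarrow> 'a set \<Rightarrow> 'a set \<Rightarrow> 'a curve set" where
  "curves_joining X E F G =
     {({a..b}, \<gamma>) | a b \<gamma>. a \<le> b \<and> is_curve X ({a..b}, \<gamma>) \<and> \<gamma> ` {a..b} \<subseteq> G \<and>
        (\<gamma> a \<in> E \<and> \<gamma> b \<in> F \<or> \<gamma> a \<in> F \<and> \<gamma> b \<in> E)}"

end

theory Submission
  imports Defs
begin

text \<open>The surface is the plane with its usual topology and \<open>E = [0,1] \<times> {0}\<close>. The nodes
  \<open>(j / 2\<^sup>k, 1 / 2\<^sup>k)\<close> form binary trees: each node is joined to its two children at height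
  \<open>1 / 2\<^sup>k\<^sup>+\<^sup>1\<close> by thin lenses. The metric stretches every lens of generation \<open>k\<close> transversally until
  its width is comparable to \<open>(2/3)\<^sup>k\<close>, while its length stays comparable to \<open>(1/2)\<^sup>k\<close>, and the boundary
  of the lens is not affected. The \<open>2\<^sup>k\<close> lenses of generation \<open>k\<close> over a unit interval can be
  covered with total squared size \<open>2\<^sup>k (4/9)\<^sup>k\<close>, which is summable. Crossing a lens lengthwise costs
  length over width, about \<open>(3/4)\<^sup>k\<close>, and all its longitudinal curves end at the same two nodes, so
  the costs along a branch of the tree add up as in a series circuit. Since every point of \<open>E\<close> is the
  end of a branch and the costs are summable, its capacity is positive.\<close>

section \<open>Hausdorff measure of Lipschitz parametrized sets\<close>

lemma hausdorff2_outer_UN_finite: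
  assumes "finite I"
  shows "hausdorff2_outer X (\<Union>i\<in>I. S i) \<le> (\<Sum>i\<in>I. hausdorff2_outer X (S i))"
  using assms
proof (induction I rule: finite_induct)
  case (insert i I)
  have "hausdorff2_outer X (\<Union>i\<in>insert i I. S i)
      \<le> hausdorff2_outer X (S i) + hausdorff2_outer X (\<Union>i\<in>I. S i)"
    using hausdorff2_outer_subadditive[of X "S i" "\<Union>i\<in>I. S i"] by simp
  also have "\<dots> \<le> hausdorff2_outer X (S i) + (\<Sum>i\<in>I. hausdorff2_outer X (S i))"
    by (intro add_left_mono insert.IH)
  finally show ?case using insert.hyps by simp
qed simp

lemma hausdorff2_pre_finite_cover:
  assumes "finite I" and "S \<subseteq> (\<Union>i\<in>I. A i)"
    and "\<And>i. i \<in> I \<Longrightarrow> A i \<subseteq> mspace X"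
    and d: "\<And>i. i \<in> I \<Longrightarrow> ediam X (A i) \<le> ennreal e" and "e \<le> \<delta>" "0 \<le> e"
  shows "hausdorff2_pre X \<delta> S \<le> ennreal (real (card I) * (pi / 4 * e\<^sup>2))"
proof -
  obtain g where g: "bij_betw g {..<card I} I"
    using ex_bij_betw_nat_finite[OF \<open>finite I\<close>] by (auto simp: atLeast0LessThan)
  \<comment> \<open>Empty sets, which contribute 0, pad the finite cover to the sequence that
    \<open>hausdorff2_pre\<close> asks for.\<close>
  define B where "B n = (if n < card I then A (g n) else {})" for n
  have gI: "g n \<in> I" if "n < card I" for n using g that by (auto simp: bij_betw_def)
  have "S \<subseteq> (\<Union>n. B n)"
  proof
    fix x assume "x \<in> S"
    then obtain i where i: "i \<in> I" "x \<in> A i" using assms by auto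
    then have "i \<in> g ` {..<card I}" using g by (simp add: bij_betw_def)
    then obtain n where "n < card I" "g n = i" by auto
    then show "x \<in> (\<Union>n. B n)" using i by (auto simp: B_def intro!: exI[of _ n])
  qed
  moreover have "ediam X (B n) \<le> ennreal e" "B n \<subseteq> mspace X" for n
    using assms gI by (auto simp: B_def)
  moreover have "ennreal e \<le> ennreal \<delta>" using assms by (simp add: ennreal_leI)
  ultimately have "hausdorff2_pre X \<delta> S \<le> (\<Sum>n. ennreal (pi / 4) * (ediam X (B n))\<^sup>2)"
    unfolding hausdorff2_pre_def by (intro INF_lower) (auto intro: order_trans)
  also have "\<dots> = (\<Sum>n<card I. ennreal (pi / 4) * (ediam X (B n))\<^sup>2)"
    by (rule suminf_finite) (auto simp: B_def)
  also have "\<dots> \<le> (\<Sum>n<card I. ennreal (pi / 4) * (ennreal e)\<^sup>2)"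
    using \<open>\<And>n. ediam X (B n) \<le> ennreal e\<close> by (intro sum_mono mult_left_mono power_mono) auto
  also have "\<dots> = ennreal (real (card I) * (pi / 4 * e\<^sup>2))"
    using \<open>0 \<le> e\<close> by (simp add: ennreal_power ennreal_of_nat_eq_real_of_nat flip: ennreal_mult)
  finally show ?thesis .
qed

text \<open>The floor is the number of the cell containing \<open>u\<close> when
  \<open>[a, a + w)\<close> is cut into \<open>n\<close> equal cells.\<close>

lemma floor_grid_index:
  fixes u a w :: real
  assumes "a \<le> u" "u < a + w" "0 < w" "0 < n"
  shows "nat \<lfloor>real n * (u - a) / w\<rfloor> < n"
proof -
  have "real n * (u - a) / w < real n" using assms by (simp add: divide_simps)
  then show ?thesis using assms by (simp add: nat_less_iff floor_less_iff)
qed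

lemma floor_grid_close:
  fixes u v a w :: real
  assumes "a \<le> u" "a \<le> v" "0 < w" "0 < n"
    and "nat \<lfloor>real n * (u - a) / w\<rfloor> = nat \<lfloor>real n * (v - a) / w\<rfloor>"
  shows "\<bar>u - v\<bar> \<le> w / real n"
proof -
  \<comment> \<open>On nonnegative numbers \<open>nat\<close> loses nothing, so equal cell numbers
    mean equal floors.\<close>
  have "0 \<le> real n * (u - a) / w" "0 \<le> real n * (v - a) / w" using assms by auto
  then have "\<lfloor>real n * (u - a) / w\<rfloor> = \<lfloor>real n * (v - a) / w\<rfloor>"
    using assms(5) by (metis eq_nat_nat_iff zero_le_floor)
  then have "\<bar>real n * (u - a) / w - real n * (v - a) / w\<bar> \<le> 1" by linarith
  also have "real n * (u - a) / w - real n * (v - a) / w = real n / w * (u - v)"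
    by (simp add: right_diff_distrib diff_divide_distrib)
  finally have "real n / w * \<bar>u - v\<bar> \<le> 1" using assms by (simp add: abs_mult)
  then show ?thesis using assms by (simp add: divide_simps mult.commute)
qed

text \<open>Cutting the parameter square of side \<open>w\<close> into \<open>n * n\<close> cells
  gives pieces of diameter at most \<open>2 * K * w / n\<close>; together they contribute
  \<open>pi * (K * w)\<^sup>2\<close>, whatever \<open>n\<close> is.\<close>

lemma hausdorff2_outer_le_parametrized:
  fixes \<phi> \<psi> :: "'a \<Rightarrow> real"
  assumes S: "S \<subseteq> mspace X" and "0 < w" "0 < K"
    and \<phi>: "\<And>p. p \<in> S \<Longrightarrow> a \<le> \<phi> p \<and> \<phi> p < a + w"
    and \<psi>: "\<And>p. p \<in> S \<Longrightarrow> b \<le> \<psi> p \<and> \<psi> p < b + w"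
    and lip: "\<And>p q. p \<in> S \<Longrightarrow> q \<in> S \<Longrightarrow> mdist X p q \<le> K * (\<bar>\<phi> p - \<phi> q\<bar> + \<bar>\<psi> p - \<psi> q\<bar>)"
  shows "hausdorff2_outer X S \<le> ennreal (pi * (K * w)\<^sup>2)"
  unfolding hausdorff2_outer_def
proof (rule SUP_least)
  fix \<delta> :: real assume "\<delta> \<in> {0<..}"
  then have "0 < \<delta>" by simp
  \<comment> \<open>This makes the diameter of the pieces less than \<open>\<delta>\<close>.\<close>
  obtain n :: nat where n: "2 * K * w / \<delta> < real n" using reals_Archimedean2 by blast
  then have "0 < n" using assms \<open>0 < \<delta>\<close> by (smt (verit) divide_pos_pos mult_pos_pos of_nat_0_less_iff)
  define i where "i p = nat \<lfloor>real n * (\<phi> p - a) / w\<rfloor>" for p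
  define j where "j p = nat \<lfloor>real n * (\<psi> p - b) / w\<rfloor>" for p
  let ?I = "{..<n} \<times> {..<n}" and ?e = "2 * K * w / real n"
  define A where "A = (\<lambda>(k, l). {p \<in> S. i p = k \<and> j p = l})"
  have "hausdorff2_pre X \<delta> S \<le> ennreal (real (card ?I) * (pi / 4 * ?e\<^sup>2))"
  proof (rule hausdorff2_pre_finite_cover)
    show "S \<subseteq> (\<Union>i\<in>?I. A i)"
      using \<phi> \<psi> floor_grid_index \<open>0 < w\<close> \<open>0 < n\<close> by (auto simp: A_def i_def j_def)
    show "ediam X (A c) \<le> ennreal ?e" if "c \<in> ?I" for c
      unfolding ediam_def
    proof (rule SUP_least, clarify)
      fix p q assume "p \<in> A c" "q \<in> A c"
      then have pq: "p \<in> S" "q \<in> S" "i p = i q" "j p = j q" by (auto simp: A_def)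
      have "\<bar>\<phi> p - \<phi> q\<bar> \<le> w / real n" "\<bar>\<psi> p - \<psi> q\<bar> \<le> w / real n"
        using pq \<phi> \<psi> \<open>0 < w\<close> \<open>0 < n\<close> floor_grid_close unfolding i_def j_def by blast+
      then have "K * (\<bar>\<phi> p - \<phi> q\<bar> + \<bar>\<psi> p - \<psi> q\<bar>) \<le> K * (w / real n + w / real n)"
        using \<open>0 < K\<close> by (intro mult_left_mono add_mono) auto
      then show "ennreal (mdist X p q) \<le> ennreal ?e"
        using lip[of p q] pq by (intro ennreal_leI) (simp add: field_simps)
    qed
    show "A c \<subseteq> mspace X" if "c \<in> ?I" for c using S by (auto simp: A_def)
    show "?e \<le> \<delta>" using n \<open>0 < n\<close> \<open>0 < \<delta>\<close> by (simp add: field_simps)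
  qed (use assms in auto)
  also have "real (card ?I) * (pi / 4 * ?e\<^sup>2) = pi * (K * w)\<^sup>2"
    using \<open>0 < n\<close> by (simp add: card_cartesian_product field_simps power2_eq_square)
  finally show "hausdorff2_pre X \<delta> S \<le> ennreal (pi * (K * w)\<^sup>2)" .
qed

section \<open>Line integrals over geodesics\<close>

lemma curve_length_isometric:
  assumes iso: "\<And>u v. u \<in> {a..b} \<Longrightarrow> v \<in> {a..b} \<Longrightarrow> mdist X (\<gamma> u) (\<gamma> v) = \<bar>u - v\<bar>"
    and "a \<le> b"
  shows "curve_length X \<gamma> a b = ennreal (b - a)"
proof (rule antisym)
  show "curve_length X \<gamma> a b \<le> ennreal (b - a)"
    unfolding curve_length_def
  proof (rule SUP_least, clarify)
    fix n :: nat and t :: "nat \<Rightarrow> real"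
    assume t: "mono_on {..n} t" "t ` {..n} \<subseteq> {a..b}"
    have "(\<Sum>i<n. ennreal (mdist X (\<gamma> (t i)) (\<gamma> (t (Suc i))))) = (\<Sum>i<n. ennreal (t (Suc i) - t i))"
    proof (rule sum.cong[OF refl])
      fix i assume "i \<in> {..<n}"
      then have "t i \<in> {a..b}" "t (Suc i) \<in> {a..b}" "t i \<le> t (Suc i)"
        using t by (auto simp: image_subset_iff intro: mono_onD[OF t(1)])
      then show "ennreal (mdist X (\<gamma> (t i)) (\<gamma> (t (Suc i)))) = ennreal (t (Suc i) - t i)"
        using iso by simp
    qed
    also have "\<dots> = ennreal (\<Sum>i<n. t (Suc i) - t i)"
      by (rule sum_ennreal) (auto intro: mono_onD[OF t(1)])
    also have "(\<Sum>i<n. t (Suc i) - t i) = t n - t 0" by (rule sum_lessThan_telescope)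
    also have "ennreal (t n - t 0) \<le> ennreal (b - a)"
    proof (rule ennreal_leI)
      have "t n \<in> {a..b}" "t 0 \<in> {a..b}" using t(2) by auto
      then show "t n - t 0 \<le> b - a" by simp
    qed
    finally show "(\<Sum>i<n. ennreal (mdist X (\<gamma> (t i)) (\<gamma> (t (Suc i))))) \<le> ennreal (b - a)" .
  qed
  define t where "t i = (if i = 0 then a else b)" for i :: nat
  have "ennreal (b - a) = (\<Sum>i<(1::nat). ennreal (mdist X (\<gamma> (t i)) (\<gamma> (t (Suc i)))))"
    using iso[of a b] \<open>a \<le> b\<close> by (simp add: t_def)
  also have "\<dots> \<le> curve_length X \<gamma> a b"
    unfolding curve_length_def
    by (rule SUP_upper2[of "(1, t)"]) (use \<open>a \<le> b\<close> in \<open>auto simp: t_def mono_on_def\<close>)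
  finally show "ennreal (b - a) \<le> curve_length X \<gamma> a b" .
qed

text \<open>The arc length at \<open>t\<close> is \<open>t - a\<close>, so the choice in
  \<open>arclength_param\<close> is unique. \<open>F\<close> extends the integrand from
  \<open>{a..b}\<close> to a Borel function on the line, which the translation of the Lebesgue
  integral requires.\<close>

lemma compact_line_integral_isometric:
  assumes iso: "\<And>u v. u \<in> {a..b} \<Longrightarrow> v \<in> {a..b} \<Longrightarrow> mdist X (\<gamma> u) (\<gamma> v) = \<bar>u - v\<bar>"
    and "a \<le> b" and F: "F \<in> borel_measurable borel" "\<And>t. t \<in> {a..b} \<Longrightarrow> F t = \<rho> (\<gamma> t)"
  shows "compact_line_integral X \<rho> \<gamma> a b = (\<integral>\<^sup>+ t\<in>{a..b}. F t \<partial>lborel)"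
proof -
  have len: "curve_length X \<gamma> a t = ennreal (t - a)" if "t \<in> {a..b}" for t
    using that iso by (intro curve_length_isometric) auto
  have "arclength_param X \<gamma> a b s = \<gamma> (a + s)" if "s \<in> {0..b - a}" for s
  proof -
    have "(SOME t. t \<in> {a..b} \<and> curve_length X \<gamma> a t = ennreal s) = a + s"
    proof (rule some_equality)
      show "a + s \<in> {a..b} \<and> curve_length X \<gamma> a (a + s) = ennreal s" using that len by auto
      show "t = a + s" if "t \<in> {a..b} \<and> curve_length X \<gamma> a t = ennreal s" for t
        using that len[of t] \<open>s \<in> {0..b - a}\<close> by (auto simp: ennreal_inj)
    qed
    then show ?thesis by (simp add: arclength_param_def)
  qed
  then have "compact_line_integral X \<rho> \<gamma> a b
      = (\<integral>\<^sup>+ s. F (a + 1 * s) * indicator {a..b} (a + 1 * s) \<partial>lborel)"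
    unfolding compact_line_integral_def using len[of b] \<open>a \<le> b\<close>
    by (intro nn_integral_cong) (auto simp: F(2) split: split_indicator)
  also have "\<dots> = (\<integral>\<^sup>+ t\<in>{a..b}. F t \<partial>lborel)"
    using nn_integral_real_affine[of "\<lambda>t. F t * indicator {a..b} t" 1 a] F(1) by simp
  finally show ?thesis .
qed

lemma line_integral_isometric_le:
  assumes iso: "\<And>u v. u \<in> {a..b} \<Longrightarrow> v \<in> {a..b} \<Longrightarrow> mdist X (\<gamma> u) (\<gamma> v) = \<bar>u - v\<bar>"
    and F: "F \<in> borel_measurable borel" "\<And>t. t \<in> {a..b} \<Longrightarrow> F t = \<rho> (\<gamma> t)"
  shows "line_integral X \<rho> ({a..b}, \<gamma>) \<le> (\<integral>\<^sup>+ t\<in>{a..b}. F t \<partial>lborel)"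
  unfolding line_integral_def prod.case
proof (rule SUP_least, clarify)
  fix c d assume cd: "c \<le> d" "{c..d} \<subseteq> {a..b}"
  then have "compact_line_integral X \<rho> \<gamma> c d = (\<integral>\<^sup>+ t\<in>{c..d}. F t \<partial>lborel)"
    using iso F by (intro compact_line_integral_isometric) auto
  also have "\<dots> \<le> (\<integral>\<^sup>+ t\<in>{a..b}. F t \<partial>lborel)"
    using cd by (intro nn_integral_mono) (auto split: split_indicator)
  finally show "compact_line_integral X \<rho> \<gamma> c d \<le> (\<integral>\<^sup>+ t\<in>{a..b}. F t \<partial>lborel)" .
qed

lemma locally_rectifiable_isometric:
  assumes "\<And>u v. u \<in> {a..b} \<Longrightarrow> v \<in> {a..b} \<Longrightarrow> mdist X (\<gamma> u) (\<gamma> v) = \<bar>u - v\<bar>"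
  shows "locally_rectifiable X ({a..b}, \<gamma>)"
  unfolding locally_rectifiable_def prod.case
proof (intro allI impI)
  fix c d assume "c \<le> d" "{c..d} \<subseteq> {a..b}"
  then have "curve_length X \<gamma> c d = ennreal (d - c)"
    using assms by (intro curve_length_isometric) auto
  then show "curve_length X \<gamma> c d < \<infinity>" by simp
qed

section \<open>The metric\<close>

text \<open>The quotient metric on the image of \<open>(f, \<delta>)\<close> after the line \<open>\<delta> = 0\<close> is collapsed to a
  point.\<close>

definition cone_dist :: "('a \<Rightarrow> real) \<Rightarrow> ('a \<Rightarrow> real) \<Rightarrow> 'a \<Rightarrow> 'a \<Rightarrow> real" where
  "cone_dist f \<delta> p q = min (max \<bar>f p - f q\<bar> \<bar>\<delta> p - \<delta> q\<bar>) (\<delta> p + \<delta> q)"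

text \<open>The plane terms separate the points that the cone distance identifies. The weight
  \<open>1 / 2\<close> lets curves move horizontally up to twice as fast as vertically, so that
  along the geodesics built below the vertical term decides.\<close>

definition pinched_dist ::
    "(real \<times> real \<Rightarrow> real) \<Rightarrow> (real \<times> real \<Rightarrow> real) \<Rightarrow> real \<times> real \<Rightarrow> real \<times> real \<Rightarrow> real" where
  "pinched_dist f \<delta> p q =
     max (max (\<bar>fst p - fst q\<bar> / 2) \<bar>snd p - snd q\<bar>) (cone_dist f \<delta> p q)"

text \<open>Since \<open>\<delta>\<close> is 1-Lipschitz for the maximum distance, a direct leg
  followed by a detour through the collapsed line is no shorter than a detour taken from the
  start.\<close>

lemma cone_dist_triangle:
  assumes "\<And>p. 0 \<le> \<delta> p"
  shows "cone_dist f \<delta> p r \<le> cone_dist f \<delta> p q + cone_dist f \<delta> q r"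
proof -
  define e where "e u v = max \<bar>f u - f v\<bar> \<bar>\<delta> u - \<delta> v\<bar>" for u v
  have "e p r \<le> e p q + e q r" unfolding e_def by (auto simp: max_def)
  moreover have "\<bar>\<delta> u - \<delta> v\<bar> \<le> e u v" for u v by (simp add: e_def)
  from this[of p q] this[of q r]
  have "\<delta> p \<le> e p q + \<delta> q" "\<delta> r \<le> e q r + \<delta> q" by linarith+
  ultimately show ?thesis
    using assms[of p] assms[of q] assms[of r] unfolding cone_dist_def e_def[symmetric]
    by (auto simp: min_def)
qed

lemma pinched_dist_ge:
  "\<bar>fst p - fst q\<bar> \<le> 2 * pinched_dist f \<delta> p q" "\<bar>snd p - snd q\<bar> \<le> pinched_dist f \<delta> p q"
  "cone_dist f \<delta> p q \<le> pinched_dist f \<delta> p q"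
  by (auto simp: pinched_dist_def max_def)

lemma pinched_dist_le_iff:
  "pinched_dist f \<delta> p q \<le> c \<longleftrightarrow>
     \<bar>fst p - fst q\<bar> \<le> 2 * c \<and> \<bar>snd p - snd q\<bar> \<le> c \<and> cone_dist f \<delta> p q \<le> c"
  by (auto simp: pinched_dist_def)

lemma Metric_space_pinched_dist:
  assumes "\<And>p. 0 \<le> \<delta> p"
  shows "Metric_space UNIV (pinched_dist f \<delta>)"
proof
  fix p q r :: "real \<times> real"
  show "0 \<le> pinched_dist f \<delta> p q" by (simp add: pinched_dist_def le_max_iff_disj)
  show "pinched_dist f \<delta> p q = pinched_dist f \<delta> q p"
    by (simp add: pinched_dist_def cone_dist_def abs_minus_commute add.commute)
  show "pinched_dist f \<delta> p q = 0 \<longleftrightarrow> p = q"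
  proof
    assume "pinched_dist f \<delta> p q = 0"
    then show "p = q" using pinched_dist_ge(1,2)[of p q f \<delta>] by (simp add: prod_eq_iff)
  qed (use assms[of p] in \<open>simp add: pinched_dist_def cone_dist_def\<close>)
  show "pinched_dist f \<delta> p r \<le> pinched_dist f \<delta> p q + pinched_dist f \<delta> q r"
    unfolding pinched_dist_le_iff
  proof (intro conjI)
    note pq = pinched_dist_ge[where f = f and \<delta> = \<delta> and p = p and q = q]
      and qr = pinched_dist_ge[where f = f and \<delta> = \<delta> and p = q and q = r]
    show "\<bar>fst p - fst r\<bar> \<le> 2 * (pinched_dist f \<delta> p q + pinched_dist f \<delta> q r)"
      using pq(1) qr(1) unfolding abs_le_iff by argo
    show "\<bar>snd p - snd r\<bar> \<le> pinched_dist f \<delta> p q + pinched_dist f \<delta> q r"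
      using pq(2) qr(2) unfolding abs_le_iff by argo
    show "cone_dist f \<delta> p r \<le> pinched_dist f \<delta> p q + pinched_dist f \<delta> q r"
      using pq(3) qr(3) cone_dist_triangle[of \<delta>, OF assms, where f = f and p = p and q = q and r = r] by linarith
  qed
qed

text \<open>Where \<open>\<delta>\<close> vanishes \<open>f\<close> may jump, but the cone distance
  from such a point is at most \<open>\<delta>\<close>, which is small nearby. Conversely the plane
  terms control the Euclidean distance.\<close>

lemma pinched_topology:
  assumes \<delta>0: "\<And>p. 0 \<le> \<delta> p" and \<delta>: "continuous_on UNIV \<delta>"
    and f: "\<And>p. 0 < \<delta> p \<Longrightarrow> isCont f p"
  shows "mtopology_of (metric (UNIV, pinched_dist f \<delta>)) = euclidean"
proof -
  let ?d = "pinched_dist f \<delta>"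
  interpret Metric_space UNIV ?d by (rule Metric_space_pinched_dist[OF \<delta>0])
  have "openin mtopology U \<longleftrightarrow> open U" for U
  proof
    assume U: "openin mtopology U"
    show "open U"
      unfolding open_contains_ball
    proof
      fix p assume "p \<in> U"
      then obtain r where r: "0 < r" "mball p r \<subseteq> U" using U unfolding openin_mtopology by blast
      have c\<delta>: "(\<delta> \<longlongrightarrow> \<delta> p) (nhds p)"
        using \<delta> by (simp add: continuous_on_eq_continuous_at isCont_def tendsto_at_iff_tendsto_nhds del: split_paired_All)
      have "(cone_dist f \<delta> p \<longlongrightarrow> 0) (nhds p)"
      proof (cases "0 < \<delta> p")
        case True
        then have cf: "(f \<longlongrightarrow> f p) (nhds p)"
          using f by (simp add: isCont_def tendsto_at_iff_tendsto_nhds)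
        have "(cone_dist f \<delta> p \<longlongrightarrow> min (max \<bar>f p - f p\<bar> \<bar>\<delta> p - \<delta> p\<bar>) (\<delta> p + \<delta> p)) (nhds p)"
          unfolding cone_dist_def by (intro tendsto_intros cf c\<delta>)
        then show ?thesis using True by simp
      next
        case False
        then have [simp]: "\<delta> p = 0" using \<delta>0[of p] by linarith
        show ?thesis
        proof (rule tendsto_sandwich[where f = "\<lambda>_. 0" and h = \<delta>])
          show "(\<delta> \<longlongrightarrow> 0) (nhds p)" using c\<delta> by simp
          show "((\<lambda>q. 0) \<longlongrightarrow> (0::real)) (nhds p)" by simp
          show "\<forall>\<^sub>F q in nhds p. 0 \<le> cone_dist f \<delta> p q"
            using \<delta>0 by (auto simp: cone_dist_def le_max_iff_disj)
          show "\<forall>\<^sub>F q in nhds p. cone_dist f \<delta> p q \<le> \<delta> q"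
            by (intro always_eventually) (simp add: cone_dist_def)
        qed
      qed
      then have "(?d p \<longlongrightarrow> max (max (\<bar>fst p - fst p\<bar> / 2) \<bar>snd p - snd p\<bar>) 0) (nhds p)"
        unfolding pinched_dist_def by (intro tendsto_intros filterlim_ident) auto
      then have "\<forall>\<^sub>F q in nhds p. ?d p q < r"
        using r(1) by (intro order_tendstoD) auto
      then obtain e where e: "0 < e" "\<And>q. dist q p < e \<Longrightarrow> ?d p q < r"
        unfolding eventually_nhds_metric by blast
      then have "ball p e \<subseteq> U" using r(2) by (auto simp: dist_commute)
      then show "\<exists>e>0. ball p e \<subseteq> U" using e(1) by blast
    qed
  next
    assume U: "open U"
    show "openin mtopology U"
      unfolding openin_mtopology
    proof (intro conjI allI impI)
      fix p assume "p \<in> U"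
      then obtain e where e: "0 < e" "ball p e \<subseteq> U" using U open_contains_ball by blast
      have "mball p (e / 4) \<subseteq> ball p e"
      proof
        fix q assume "q \<in> mball p (e / 4)"
        then have "\<bar>fst p - fst q\<bar> < e / 2" "\<bar>snd p - snd q\<bar> < e / 4"
          using pinched_dist_ge(1,2)[of p q f \<delta>] by auto
        moreover have "dist p q \<le> \<bar>fst p - fst q\<bar> + \<bar>snd p - snd q\<bar>"
          by (simp add: dist_prod_def dist_real_def sqrt_sum_squares_le_sum_abs)
        ultimately show "q \<in> ball p e" using e(1) by simp
      qed
      then show "\<exists>r>0. mball p r \<subseteq> U" using e by (intro exI[of _ "e / 4"]) auto
    qed simp
  qed
  then show ?thesis by (simp add: topology_eq mtopology_of)
qed

text \<open>Charts must land in the closed half-plane, so \<open>exp\<close> in the second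
  coordinate maps the whole plane onto the open half-plane as one global chart.\<close>

lemma euclidean_plane_two_manifold:
  "two_manifold_with_boundary (euclidean :: (real \<times> real) topology)"
  unfolding two_manifold_with_boundary_def
proof (intro conjI ballI)
  show "Hausdorff_space (euclidean :: (real \<times> real) topology)" by simp
  obtain \<B> :: "(real \<times> real) set set" where "countable \<B>" "topological_basis \<B>"
    using ex_countable_basis by blast
  then show "second_countable (euclidean :: (real \<times> real) topology)"
    unfolding second_countable_def
    by (intro exI[of _ \<B>]) (auto simp: topological_basis_open elim!: topological_basisE)
  fix p :: "real \<times> real"
  let ?V = "UNIV \<times> {0<..} :: (real \<times> real) set"
  have "openin (top_of_set {p::real \<times> real. 0 \<le> snd p}) ?V"
    by (rule open_subset) (auto intro: open_Times)
  moreover have "homeomorphic_maps euclidean (top_of_set ?V)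
      (\<lambda>(x::real, y). (x, exp y)) (\<lambda>(x, y). (x, ln y))"
    unfolding homeomorphic_maps_def
    by (auto simp: continuous_map_in_subtopology split_beta intro!: continuous_intros)
  then have "subtopology (euclidean :: (real \<times> real) topology) UNIV homeomorphic_space top_of_set ?V"
    unfolding homeomorphic_space_def subtopology_UNIV by blast
  ultimately show "\<exists>U V. openin euclidean U \<and> p \<in> U \<and>
      openin (top_of_set {p::real \<times> real. 0 \<le> snd p}) V \<and>
      subtopology euclidean U homeomorphic_space top_of_set V"
    by (intro exI[of _ UNIV] exI[of _ ?V]) auto
qed

section \<open>Lenses\<close>

text \<open>The lower edge of the strip of level \<open>k\<close>, whose upper edge is
  \<open>2 * height k\<close>.\<close>

definition height :: "nat \<Rightarrow> real" where
  "height k = (1 / 2) ^ Suc k"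

text \<open>For \<open>0 < y \<le> 1\<close> this is the \<open>k\<close> with
  \<open>height k < y \<le> 2 * height k\<close>, so a dyadic height belongs to the strip below
  it.\<close>

definition level :: "real \<Rightarrow> nat" where
  "level y = (LEAST k. height k < y)"

text \<open>Negative or zero for \<open>y \<le> 0\<close> and for \<open>y \<ge> 1\<close>, whatever \<^const>\<open>level\<close> is there; so no
  lens leaves the strip \<open>0 < y < 1\<close>.\<close>

definition margin :: "real \<Rightarrow> real" where
  "margin y = min (y - height (level y)) (2 * height (level y) - y)"

text \<open>The distance from \<open>u\<close> to the lattice of multiples of \<open>w\<close>, for
  \<open>w > 0\<close>.\<close>

definition near :: "real \<Rightarrow> real \<Rightarrow> real" where
  "near w u = \<bar>u - w * of_int (round (u / w))\<bar>"

text \<open>In the strip of level \<open>k\<close> the lenses have the vertical axes \<open>x \<in> w\<int>\<close> and the slanted axes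
  \<open>x + y \<in> w\<int>\<close>, where \<open>w = 2 * height k\<close>.\<close>

definition offset :: "nat \<Rightarrow> real \<times> real \<Rightarrow> real" where
  "offset k p = min (near (2 * height k) (fst p)) (near (2 * height k) (fst p + snd p))"

text \<open>Positive exactly inside the lenses, where the horizontal distance to an axis is below a
  quarter of the margin; the quarter keeps neighbouring lenses apart.\<close>

definition depth :: "real \<times> real \<Rightarrow> real" where
  "depth p = max 0 (margin (snd p) - 4 * offset (level (snd p)) p)"

text \<open>The stretched transversal coordinate; it is unsigned, so it takes every value on both sides of
  the axis. On the ends of the lens, where the margin vanishes, its (junk) value is irrelevant because the
  depth is zero.\<close>

definition coord :: "real \<times> real \<Rightarrow> real" where
  "coord p = (2 / 3) ^ level (snd p) * offset (level (snd p)) p / margin (snd p)"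

definition lens_dist :: "real \<times> real \<Rightarrow> real \<times> real \<Rightarrow> real" where
  "lens_dist = pinched_dist coord depth"

definition lens_plane :: "(real \<times> real) metric" where
  "lens_plane = metric (UNIV, lens_dist)"

section \<open>Dyadic strips and distances to the axes\<close>

lemma height_pos [simp]: "0 < height k"
  by (simp add: height_def)

lemma height_Suc: "2 * height (Suc k) = height k"
  by (simp add: height_def)

lemma two_height: "2 * height k = (1 / 2) ^ k"
  by (simp add: height_def)

lemma height_le: "height k \<le> 1 / 2"
  using power_le_one[of "1 / 2 :: real" k] by (simp add: height_def)

lemma height_le_pow: "height k \<le> (2 / 3) ^ k"
proof -
  have "(1 / 2 :: real) ^ k \<le> (2 / 3) ^ k" by (rule power_mono) auto
  then show ?thesis using height_pos[of k] two_height[of k] by linarith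
qed

lemma level_eq:
  assumes "height k < y" "y \<le> 2 * height k"
  shows "level y = k"
  unfolding level_def
proof (rule Least_equality)
  fix i assume "height i < y"
  then have "height i < 2 * height k" using assms by linarith
  then have "(1 / 2 :: real) ^ Suc i < (1 / 2) ^ k" by (simp add: height_def)
  then have "k < Suc i" by (subst (asm) power_strict_decreasing_iff) auto
  then show "k \<le> i" by simp
qed fact

lemma level_bounds:
  assumes "0 < y" "y \<le> 1"
  shows "height (level y) < y" "y \<le> 2 * height (level y)"
proof -
  obtain n where "(1 / 2) ^ n < y" using real_arch_pow_inv[of y "1 / 2"] assms by auto
  moreover have "height n < (1 / 2) ^ n" by (simp add: height_def)
  ultimately have "height n < y" by linarith
  then show lo: "height (level y) < y" unfolding level_def by (rule LeastI)
  show "y \<le> 2 * height (level y)"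
  proof (cases "level y")
    case (Suc i)
    then have "\<not> height i < y" unfolding level_def using not_less_Least by (metis lessI)
    then show ?thesis by (simp add: Suc height_Suc)
  qed (use assms in \<open>simp add: height_def\<close>)
qed

text \<open>Leaving the strip of \<open>y\<close> takes at least the distance from \<open>y\<close>
  to its edges.\<close>

lemma margin_level_neq:
  assumes "level y \<noteq> level z" shows "margin y \<le> \<bar>y - z\<bar>"
proof (rule ccontr)
  assume *: "\<not> ?thesis"
  then have "height (level y) < z" "z \<le> 2 * height (level y)"
    by (auto simp: margin_def)
  then have "level z = level y" by (rule level_eq)
  then show False using assms by simp
qed

lemma margin_lipschitz:
  assumes "level y = level z" shows "\<bar>margin y - margin z\<bar> \<le> \<bar>y - z\<bar>"
  using assms by (auto simp: margin_def)

lemma margin_le: "margin y \<le> height (level y) / 2"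
  by (simp add: margin_def min_def)

lemma near_le:
  assumes "0 < w" shows "near w u \<le> \<bar>u - w * of_int j\<bar>"
proof -
  have "w * \<bar>u / w - of_int (round (u / w))\<bar> \<le> w * \<bar>u / w - of_int j\<bar>"
    using assms by (intro mult_left_mono round_diff_minimal) auto
  moreover have "w * \<bar>u / w - of_int i\<bar> = \<bar>u - w * of_int i\<bar>" for i
    using assms by (simp add: abs_mult_pos' right_diff_distrib flip: abs_mult_pos)
  ultimately show ?thesis by (simp add: near_def)
qed

lemma near_nonneg [simp]: "0 \<le> near w u"
  by (simp add: near_def)

lemma near_lipschitz:
  assumes "0 < w" shows "\<bar>near w u - near w v\<bar> \<le> \<bar>u - v\<bar>"
  using near_le[OF assms, of u "round (v / w)"] near_le[OF assms, of v "round (u / w)"]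
  unfolding near_def by linarith

text \<open>Every lattice point lies at or beyond one end of the cell from \<open>w * i\<close> to
  \<open>w * (i + 1)\<close>, so it suffices to compare \<open>u\<close> with the two ends.\<close>

lemma near_ge:
  assumes "0 < w" "w * of_int i + c \<le> u" "u \<le> w * of_int (i + 1) - c"
  shows "c \<le> near w u"
proof -
  define j where "j = round (u / w)"
  consider "j \<le> i" | "i + 1 \<le> j" by linarith
  then have "c \<le> \<bar>u - w * of_int j\<bar>"
  proof cases
    case 1
    then have "w * of_int j \<le> w * of_int i" using assms(1) by simp
    then show ?thesis using assms(2) by linarith
  next
    case 2
    then have "w * of_int (i + 1) \<le> w * of_int j" using assms(1) by (intro mult_left_mono) linarith+
    then show ?thesis using assms(3) by linarith
  qed
  then show ?thesis by (simp add: near_def j_def)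
qed

lemma offset_nonneg [simp]: "0 \<le> offset k p"
  by (simp add: offset_def)

lemma offset_lipschitz:
  "\<bar>offset k p - offset k q\<bar> \<le> \<bar>fst p - fst q\<bar> + \<bar>snd p - snd q\<bar>"
proof -
  have "\<bar>near (2 * height k) (fst p) - near (2 * height k) (fst q)\<bar> \<le> \<bar>fst p - fst q\<bar>"
    "\<bar>near (2 * height k) (fst p + snd p) - near (2 * height k) (fst q + snd q)\<bar>
      \<le> \<bar>fst p + snd p - (fst q + snd q)\<bar>"
    by (rule near_lipschitz; simp)+
  then show ?thesis unfolding offset_def by linarith
qed

lemma fst_snd_dist_le: "\<bar>fst p - fst q\<bar> + \<bar>snd p - snd q\<bar> \<le> 2 * dist p q" for p q :: "real \<times> real"
  using dist_fst_le[of p q] dist_snd_le[of p q] by (simp add: dist_real_def)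

lemma continuous_on_offset [continuous_intros]: "continuous_on A (offset k)"
proof (rule lipschitz_on_continuous_on)
  show "2-lipschitz_on A (offset k)"
  proof (rule lipschitz_onI)
    show "dist (offset k p) (offset k q) \<le> 2 * dist p q" for p q
      using offset_lipschitz[of k p q] fst_snd_dist_le[of p q] by (simp add: dist_real_def)
  qed simp
qed

section \<open>Regularity of the depth and of the stretched coordinate\<close>

lemma depth_nonneg [simp]: "0 \<le> depth p"
  by (simp add: depth_def)

lemma depth_le_margin: "depth p \<le> max 0 (margin (snd p))"
  using offset_nonneg[of "level (snd p)" p] unfolding depth_def by linarith

text \<open>Within a strip the margin contributes 1 and the offset 4. Across strips both depths are
  at most the vertical distance, because each margin is.\<close>

lemma depth_lipschitz: "\<bar>depth p - depth q\<bar> \<le> 5 * (\<bar>fst p - fst q\<bar> + \<bar>snd p - snd q\<bar>)"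
proof (cases "level (snd p) = level (snd q)")
  case True
  then show ?thesis
    using margin_lipschitz[OF True] offset_lipschitz[of "level (snd q)" p q]
    unfolding depth_def True by (smt (verit))
next
  case False
  then show ?thesis
    using margin_level_neq[OF False] margin_level_neq[OF False[symmetric]]
      depth_le_margin[of p] depth_le_margin[of q] depth_nonneg[of p] depth_nonneg[of q]
    by (smt (verit))
qed

lemma continuous_on_depth: "continuous_on A depth"
proof (rule lipschitz_on_continuous_on)
  show "10-lipschitz_on A depth"
  proof (rule lipschitz_onI)
    show "dist (depth p) (depth q) \<le> 10 * dist p q" for p q
      using depth_lipschitz[of p q] fst_snd_dist_le[of p q] by (simp add: dist_real_def)
  qed simp
qed

lemma depth_posD:
  assumes "0 < depth p"
  shows "4 * offset (level (snd p)) p < margin (snd p)" "0 < margin (snd p)"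
    "height (level (snd p)) < snd p" "snd p < 2 * height (level (snd p))"
proof -
  show *: "4 * offset (level (snd p)) p < margin (snd p)"
    using assms by (auto simp: depth_def)
  then show "0 < margin (snd p)" using offset_nonneg[of "level (snd p)" p] by linarith
  then show "height (level (snd p)) < snd p" "snd p < 2 * height (level (snd p))"
    by (auto simp: margin_def)
qed

text \<open>On the open strip around \<open>p\<close> the level is constant, and
  \<open>coord\<close> is a quotient with nonvanishing denominator.\<close>

lemma isCont_coord:
  assumes "0 < depth p" shows "isCont coord p"
proof -
  define k where "k = level (snd p)"
  let ?U = "{q::real \<times> real. height k < snd q \<and> snd q < 2 * height k}"
  let ?g = "\<lambda>q::real \<times> real. (2 / 3) ^ k * offset k q / min (snd q - height k) (2 * height k - snd q)"
  have U: "open ?U" by (intro open_Collect_conj open_Collect_less continuous_intros)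
  have p: "p \<in> ?U" using depth_posD[OF assms] by (simp add: k_def)
  have "continuous_on ?U ?g" by (intro continuous_intros) auto
  then have "isCont ?g p" using U p continuous_on_eq_continuous_at by blast
  moreover have "\<forall>\<^sub>F q in nhds p. coord q = ?g q"
    unfolding eventually_nhds
  proof (intro exI[of _ ?U] conjI ballI)
    fix q assume "q \<in> ?U"
    then have "level (snd q) = k" by (intro level_eq) auto
    then show "coord q = ?g q" by (simp add: coord_def margin_def)
  qed (use U p in auto)
  ultimately show ?thesis by (simp add: isCont_cong)
qed

section \<open>The lens plane and its topology\<close>

lemma mspace_lens_plane [simp]: "mspace lens_plane = UNIV"
  and mdist_lens_plane [simp]: "mdist lens_plane = lens_dist"
proof -
  interpret Metric_space UNIV lens_dist
    unfolding lens_dist_def by (rule Metric_space_pinched_dist) simp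
  show "mspace lens_plane = UNIV" "mdist lens_plane = lens_dist"
    by (simp_all add: lens_plane_def)
qed

lemma mtopology_of_lens_plane [simp]: "mtopology_of lens_plane = euclidean"
  unfolding lens_plane_def lens_dist_def
  by (intro pinched_topology continuous_on_depth isCont_coord) auto

lemma sets_hausdorff2_lens_plane: "sets (hausdorff2 lens_plane) = sets borel"
  by (simp add: sets_hausdorff2 borel_def)

section \<open>Local finiteness\<close>

text \<open>Half a lens: \<open>\<beta>\<close> is 0 for a vertical and 1 for a slanted axis, and
  the sign \<open>\<sigma>\<close> selects the side. As \<open>coord\<close> is unsigned, height and
  \<open>coord\<close> determine a point only within one half.\<close>

definition sheet :: "nat \<Rightarrow> int \<times> real \<times> real \<Rightarrow> (real \<times> real) set" where
  "sheet k = (\<lambda>(j, \<beta>, \<sigma>). {p. 0 < depth p \<and> level (snd p) = k \<and>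
     fst p = 2 * height k * of_int j - \<beta> * snd p + \<sigma> * offset k p})"

text \<open>On a half lens everything is a function of height and \<open>coord\<close>, since the
  offset equals \<open>coord\<close> times margin over \<open>(2 / 3) ^ k\<close>. Both factors are
  at most \<open>(2 / 3) ^ k\<close>, so the Lipschitz constant is the same for all levels.\<close>

lemma lens_dist_sheet:
  assumes p: "p \<in> sheet k (j, \<beta>, \<sigma>)" and q: "q \<in> sheet k (j, \<beta>, \<sigma>)"
    and "\<beta> \<in> {0, 1}" "\<sigma> \<in> {-1, 1}"
  shows "lens_dist p q \<le> 4 * (\<bar>snd p - snd q\<bar> + \<bar>coord p - coord q\<bar>)"
proof -
  let ?N = "(2 / 3) ^ k :: real"
  define f f' m m' g g' where "f = coord p" and "f' = coord q"
    and "m = margin (snd p)" and "m' = margin (snd q)" and "g = offset k p" and "g' = offset k q"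
  have lev: "level (snd p) = k" "level (snd q) = k" and dp: "0 < depth p" "0 < depth q"
    using p q by (auto simp: sheet_def)
  have m: "0 < m" "0 < m'" "4 * g < m" "4 * g' < m'"
    using depth_posD[OF dp(1)] depth_posD[OF dp(2)] by (simp_all add: lev m_def m'_def g_def g'_def)
  have mN: "m \<le> ?N"
    using margin_le[of "snd p"] height_le_pow[of k] height_pos[of k] unfolding m_def lev by linarith
  have dm: "\<bar>m - m'\<bar> \<le> \<bar>snd p - snd q\<bar>"
    using lev by (simp add: m_def m'_def margin_lipschitz)
  have g: "g = f * m / ?N" "g' = f' * m' / ?N"
    using m by (simp_all add: f_def f'_def coord_def lev g_def g'_def flip: m_def m'_def)
  have f': "0 \<le> f'" "4 * f' \<le> ?N"
    using m by (auto simp: f'_def coord_def lev field_simps simp flip: m'_def g'_def) (simp add: g'_def)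
  \<comment> \<open>Product rule for \<open>f * m / ?N\<close>; the coefficients are at most 1 and
    \<open>1 / 4\<close>.\<close>
  have "g - g' = m / ?N * (f - f') + f' / ?N * (m - m')"
    unfolding g by (simp add: field_simps)
  also have "\<bar>\<dots>\<bar> \<le> \<bar>m / ?N * (f - f')\<bar> + \<bar>f' / ?N * (m - m')\<bar>" by (rule abs_triangle_ineq)
  also have "\<dots> = (m / ?N) * \<bar>f - f'\<bar> + (f' / ?N) * \<bar>m - m'\<bar>"
    using m f' by (simp add: abs_mult)
  also have "\<dots> \<le> 1 * \<bar>f - f'\<bar> + (1 / 4) * \<bar>snd p - snd q\<bar>"
    using mN f' m dm by (intro add_mono mult_mono) auto
  finally have dg: "\<bar>g - g'\<bar> \<le> \<bar>f - f'\<bar> + \<bar>snd p - snd q\<bar> / 4" by simp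
  have "fst p = 2 * height k * of_int j - \<beta> * snd p + \<sigma> * g"
    "fst q = 2 * height k * of_int j - \<beta> * snd q + \<sigma> * g'"
    using p q by (auto simp: sheet_def g_def g'_def)
  then have dx: "\<bar>fst p - fst q\<bar> \<le> \<bar>snd p - snd q\<bar> + \<bar>g - g'\<bar>"
    using \<open>\<beta> \<in> {0, 1}\<close> \<open>\<sigma> \<in> {-1, 1}\<close> by auto
  have "depth p = m - 4 * g" "depth q = m' - 4 * g'"
    using m by (simp_all add: depth_def lev flip: m_def m'_def g_def g'_def)
  then have dd: "\<bar>depth p - depth q\<bar> \<le> \<bar>m - m'\<bar> + 4 * \<bar>g - g'\<bar>" by argo
  have "cone_dist coord depth p q \<le> max \<bar>f - f'\<bar> \<bar>depth p - depth q\<bar>"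
    by (simp add: cone_dist_def f_def f'_def)
  also have "\<dots> \<le> 4 * (\<bar>snd p - snd q\<bar> + \<bar>f - f'\<bar>)"
  proof (rule max.boundedI)
    show "\<bar>depth p - depth q\<bar> \<le> 4 * (\<bar>snd p - snd q\<bar> + \<bar>f - f'\<bar>)" using dd dg dm by argo
  qed auto
  finally show ?thesis
    unfolding lens_dist_def pinched_dist_le_iff f_def[symmetric] f'_def[symmetric]
    using dx dg by (intro conjI; argo)
qed

text \<open>Height and \<open>coord\<close> range over a square of side \<open>(2 / 3) ^ k\<close>,
  on which the parametrization is 4-Lipschitz.\<close>

lemma hausdorff2_outer_sheet:
  assumes "\<beta> \<in> {0, 1}" "\<sigma> \<in> {-1, 1}"
  shows "hausdorff2_outer lens_plane (sheet k (j, \<beta>, \<sigma>)) \<le> ennreal (16 * pi * (4 / 9) ^ k)"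
proof -
  let ?N = "(2 / 3) ^ k :: real"
  have "hausdorff2_outer lens_plane (sheet k (j, \<beta>, \<sigma>)) \<le> ennreal (pi * (4 * ?N)\<^sup>2)"
  proof (rule hausdorff2_outer_le_parametrized[where \<phi> = snd and \<psi> = coord and a = "height k" and b = 0])
    fix p assume p: "p \<in> sheet k (j, \<beta>, \<sigma>)"
    then have "level (snd p) = k" "0 < depth p" by (auto simp: sheet_def)
    note pos = depth_posD[OF this(2), unfolded this(1)]
    show "height k \<le> snd p \<and> snd p < height k + ?N"
      using pos height_le_pow[of k] by linarith
    show "0 \<le> coord p \<and> coord p < 0 + ?N"
    proof -
      have "offset k p / margin (snd p) < 1" using pos(1,2) offset_nonneg[of k p] by (subst divide_less_eq_1_pos) linarith+
      then have "?N * (offset k p / margin (snd p)) < ?N * 1" by (rule mult_strict_left_mono) simp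
      then show ?thesis using pos \<open>level (snd p) = k\<close> by (simp add: coord_def)
    qed
  next
    fix p q assume "p \<in> sheet k (j, \<beta>, \<sigma>)" "q \<in> sheet k (j, \<beta>, \<sigma>)"
    then show "mdist lens_plane p q \<le> 4 * (\<bar>snd p - snd q\<bar> + \<bar>coord p - coord q\<bar>)"
      using lens_dist_sheet assms by simp
  qed auto
  also have "pi * (4 * ?N)\<^sup>2 = 16 * pi * (4 / 9) ^ k"
    by (simp add: power_mult_distrib power2_eq_square flip: power_mult_distrib)
  finally show ?thesis .
qed

lemma sheet_cover:
  assumes "0 < depth p" "level (snd p) = k" "\<bar>fst p\<bar> \<le> R"
  shows "\<exists>i \<in> {- \<lceil>(R + 2) * 2 ^ k\<rceil>..\<lceil>(R + 2) * 2 ^ k\<rceil>} \<times> {0, 1} \<times> {-1, 1}. p \<in> sheet k i"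
proof -
  note pos = depth_posD[OF assms(1), unfolded assms(2)]
  \<comment> \<open>The axis family realizing the offset gives \<open>\<beta>\<close>, rounding
    gives \<open>j\<close>, and the side of the axis gives \<open>\<sigma>\<close>.\<close>
  have "offset k p = near (2 * height k) (fst p + 0 * snd p)
      \<or> offset k p = near (2 * height k) (fst p + 1 * snd p)"
    by (auto simp: offset_def min_def)
  then obtain \<beta> :: real where \<beta>: "\<beta> \<in> {0, 1}" "offset k p = near (2 * height k) (fst p + \<beta> * snd p)"
    by blast
  define j where "j = round ((fst p + \<beta> * snd p) / (2 * height k))"
  have off: "offset k p = \<bar>fst p + \<beta> * snd p - 2 * height k * of_int j\<bar>"
    using \<beta> by (simp add: near_def j_def)
  then obtain \<sigma> :: real where \<sigma>: "\<sigma> \<in> {-1, 1}" "fst p = 2 * height k * of_int j - \<beta> * snd p + \<sigma> * offset k p"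
    by (cases "fst p + \<beta> * snd p \<ge> 2 * height k * of_int j")
      (force simp: abs_if)+
  have "\<bar>\<beta> * snd p\<bar> \<le> 1" using \<beta>(1) pos height_le[of k] height_pos[of k] by auto
  moreover have "offset k p \<le> 1"
    using pos margin_le[of "snd p"] height_le[of k] unfolding assms(2) by linarith
  ultimately have "\<bar>2 * height k * of_int j\<bar> \<le> R + 2" using off assms(3) by linarith
  then have "\<bar>of_int j :: real\<bar> \<le> (R + 2) * 2 ^ k"
    unfolding two_height by (simp add: abs_mult power_one_over field_simps)
  then have "j \<in> {- \<lceil>(R + 2) * 2 ^ k\<rceil>..\<lceil>(R + 2) * 2 ^ k\<rceil>}"
    by (simp add: abs_le_iff) linarith
  then show ?thesis using \<beta>(1) \<sigma> assms(1,2)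
    by (intro bexI[of _ "(j, \<beta>, \<sigma>)"]) (auto simp: sheet_def)
qed

text \<open>A bounded region meets of order \<open>2 ^ k\<close> half lenses of level
  \<open>k\<close>, each of area of order \<open>(4 / 9) ^ k\<close>, so the total is dominated by a
  geometric series of ratio \<open>8 / 9\<close>.\<close>

lemma locally_finite_lens_plane: "locally_finite_hausdorff2 lens_plane"
  unfolding locally_finite_hausdorff2_def
proof (intro ballI)
  fix z :: "real \<times> real"
  define U where "U = {fst z - 1<..<fst z + 1} \<times> {snd z - 1<..<snd z + 1}"
  define R where "R = \<bar>fst z\<bar> + 1"
  define A where "A k = \<lceil>(R + 2) * 2 ^ k\<rceil>" for k :: nat
  define I where "I k = {- A k..A k} \<times> {0, 1::real} \<times> {-1, 1::real}" for k
  define L where "L k = (\<Union>i\<in>I k. sheet k i)" for k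
  let ?\<mu> = "hausdorff2_outer lens_plane"
  have "1 \<le> R" by (simp add: R_def)
  \<comment> \<open>Between points of depth 0 the cone distance vanishes, so plane coordinates serve
    as parameters on a square of side 2.\<close>
  have "?\<mu> (U \<inter> {p. depth p = 0}) \<le> ennreal (pi * (1 * 2)\<^sup>2)"
  proof (rule hausdorff2_outer_le_parametrized[where \<phi> = fst and \<psi> = snd
        and a = "fst z - 1" and b = "snd z - 1"])
    fix p q assume "p \<in> U \<inter> {p. depth p = 0}" "q \<in> U \<inter> {p. depth p = 0}"
    then show "mdist lens_plane p q \<le> 1 * (\<bar>fst p - fst q\<bar> + \<bar>snd p - snd q\<bar>)"
      by (auto simp: lens_dist_def pinched_dist_le_iff cone_dist_def)
  qed (auto simp: U_def)
  then have flat: "?\<mu> (U \<inter> {p. depth p = 0}) < top"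
    by (rule le_less_trans) simp
  \<comment> \<open>The product of the factors \<open>4 * (2 * R + 7)\<close> from the number of
    half lenses and \<open>16 * pi\<close> from the area of each.\<close>
  let ?C = "64 * pi * (2 * R + 7)"
  have L: "?\<mu> (L k) \<le> ennreal (?C * (8 / 9) ^ k)" for k
  proof -
    have "0 < (R + 2) * 2 ^ k" using \<open>1 \<le> R\<close> by simp
    then have "0 < A k" by (simp add: A_def)
    have "?\<mu> (L k) \<le> (\<Sum>i\<in>I k. ?\<mu> (sheet k i))"
      unfolding L_def by (rule hausdorff2_outer_UN_finite) (simp add: I_def)
    also have "\<dots> \<le> (\<Sum>i\<in>I k. ennreal (16 * pi * (4 / 9) ^ k))"
      by (rule sum_mono) (auto simp: I_def intro!: hausdorff2_outer_sheet)
    also have "\<dots> = ennreal (real (card (I k)) * (16 * pi * (4 / 9) ^ k))"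
      by (simp add: ennreal_of_nat_eq_real_of_nat flip: ennreal_mult)
    also have "\<dots> \<le> ennreal ((4 * (2 * R + 7) * 2 ^ k) * (16 * pi * (4 / 9) ^ k))"
    proof (intro ennreal_leI mult_right_mono)
      have "real (card (I k)) = 4 * (2 * of_int (A k) + 1)"
        using \<open>0 < A k\<close> by (simp add: I_def card_cartesian_product)
      also have "of_int (A k) \<le> (R + 2) * 2 ^ k + 1" unfolding A_def by linarith
      also have "4 * (2 * ((R + 2) * 2 ^ k + 1) + 1) \<le> 4 * (2 * R + 7) * 2 ^ k"
        using one_le_power[of "2::real" k] by (simp add: field_simps)
      finally show "real (card (I k)) \<le> 4 * (2 * R + 7) * 2 ^ k" by simp
    qed simp
    also have "(4 * (2 * R + 7) * 2 ^ k) * (16 * pi * (4 / 9) ^ k) = ?C * (2 ^ k * (4 / 9) ^ k)"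
      by simp
    also have "(2::real) ^ k * (4 / 9) ^ k = (8 / 9) ^ k"
      by (simp flip: power_mult_distrib)
    finally show ?thesis .
  qed
  have "(\<Sum>k. ?\<mu> (L k)) \<le> (\<Sum>k. ennreal (?C * (8 / 9) ^ k))"
    by (intro suminf_le L) auto
  also have "\<dots> < top"
    using \<open>1 \<le> R\<close> by (subst suminf_ennreal2) (auto intro!: summable_mult summable_geometric)
  finally have lenses: "(\<Sum>k. ?\<mu> (L k)) < top" .
  have "U \<subseteq> (U \<inter> {p. depth p = 0}) \<union> (\<Union>k. L k)"
  proof
    fix p assume p: "p \<in> U"
    show "p \<in> (U \<inter> {p. depth p = 0}) \<union> (\<Union>k. L k)"
    proof (cases "depth p = 0")
      case False
      then have "0 < depth p" using depth_nonneg[of p] by linarith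
      moreover have "\<bar>fst p\<bar> \<le> R" using p by (auto simp: U_def R_def)
      ultimately show ?thesis
        using sheet_cover[of p "level (snd p)" R] by (auto simp: L_def I_def A_def)
    qed (use p in simp)
  qed
  then have "?\<mu> U \<le> ?\<mu> (U \<inter> {p. depth p = 0}) + ?\<mu> (\<Union>k. L k)"
    using hausdorff2_outer_mono hausdorff2_outer_subadditive order_trans by blast
  also have "\<dots> \<le> ?\<mu> (U \<inter> {p. depth p = 0}) + (\<Sum>k. ?\<mu> (L k))"
    by (intro add_left_mono hausdorff2_outer_countably_subadditive)
  also have "\<dots> < top" using flat lenses by simp
  finally have "?\<mu> U < top" .
  moreover have "open U" by (auto simp: U_def intro: open_Times)
  moreover have "z \<in> U" by (cases z) (simp add: U_def)
  ultimately show "\<exists>U. openin (mtopology_of lens_plane) U \<and> z \<in> U \<and>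
      emeasure (hausdorff2 lens_plane) U < \<infinity>"
    by (intro exI[of _ U]) (auto simp: emeasure_hausdorff2 sets_hausdorff2_lens_plane)
qed

section \<open>Geodesics through the lenses\<close>

text \<open>A strand follows the axis of a lens on the branch towards \<open>(a, 0)\<close> at constant relative offset
  \<open>s\<close>; it is therefore geodesic, being a graph over the \<open>y\<close>-axis on which the stretched coordinate is
  constant.\<close>

definition node :: "real \<Rightarrow> nat \<Rightarrow> int" where
  "node a k = \<lfloor>a * 2 ^ k\<rfloor>"

definition strand :: "real \<Rightarrow> nat \<Rightarrow> real \<times> real \<Rightarrow> real \<times> real" where
  "strand a k = (\<lambda>(s, y).
     (2 * height k * of_int (node a k) + of_int (node a (Suc k) - 2 * node a k) * (2 * height k - y)
        + s * min (y - height k) (2 * height k - y), y))"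

text \<open>The strands of all levels with the same \<open>s\<close>, strung together; they fit at
  the nodes.\<close>

definition thread :: "real \<Rightarrow> real \<Rightarrow> real \<Rightarrow> real \<times> real" where
  "thread a s y = strand a (level y) (s, y)"

lemma snd_strand [simp]: "snd (strand a k p) = snd p"
  by (simp add: strand_def split_beta)

text \<open>This is the next binary digit of \<open>a\<close>; in \<open>strand\<close>, 0 selects
  the vertical and 1 the slanted lens below the node.\<close>

lemma node_Suc: "node a (Suc k) - 2 * node a k \<in> {0, 1}"
proof -
  have "a * 2 ^ Suc k = 2 * (a * 2 ^ k)" by simp
  then show ?thesis unfolding node_def by (simp only: insert_iff) linarith
qed

lemma continuous_on_strand [continuous_intros]: "continuous_on A (strand a k)"
  unfolding strand_def split_beta by (intro continuous_intros)

text \<open>The strand runs at horizontal distance \<open>s\<close> times margin from its own axis.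
  All other axes are farther away, because near the strand the axes are at least a margin apart and
  \<open>s \<le> 1 / 8\<close>.\<close>

lemma offset_strand:
  assumes s: "0 \<le> s" "s \<le> 1 / 8" and y: "height k \<le> y" "y \<le> 2 * height k"
  shows "offset k (strand a k (s, y)) = s * min (y - height k) (2 * height k - y)"
proof -
  define h m x where "h = height k" and "m = min (y - h) (2 * h - y)"
    and "x = fst (strand a k (s, y))"
  have m: "0 \<le> m" "m \<le> y - h" "m \<le> 2 * h - y" using y by (auto simp: m_def h_def)
  have "s * m \<le> 1 / 8 * m" using s m by (intro mult_right_mono) auto
  then have sm: "0 \<le> s * m" "8 * (s * m) \<le> m" using s m by auto
  have h: "0 < 2 * h" by (simp add: h_def)
  note le = near_le[OF h] and ge = near_ge[OF h]
  have "min (near (2 * h) x) (near (2 * h) (x + y)) = s * m"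
  proof (cases "node a (Suc k) - 2 * node a k = 0")
    case True
    then have x: "x = 2 * h * of_int (node a k) + s * m"
      by (simp add: x_def strand_def flip: h_def m_def)
    have "near (2 * h) x = s * m"
    proof (rule antisym)
      show "near (2 * h) x \<le> s * m" using le[of x "node a k"] sm by (simp add: x)
      show "s * m \<le> near (2 * h) x"
        using sm m y by (intro ge[of "node a k"]) (simp_all add: x algebra_simps flip: h_def)
    qed
    moreover have "s * m \<le> near (2 * h) (x + y)"
      using sm m y by (intro ge[of "node a k"]) (simp_all add: x algebra_simps flip: h_def)
    ultimately show ?thesis by simp
  next
    case False
    then have "node a (Suc k) - 2 * node a k = 1" using node_Suc[of a k] by simp
    then have x: "x = 2 * h * of_int (node a k) + (2 * h - y) + s * m"
      by (simp add: x_def strand_def flip: h_def m_def)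
    have "near (2 * h) (x + y) = s * m"
    proof (rule antisym)
      show "near (2 * h) (x + y) \<le> s * m"
        using le[of "x + y" "node a k + 1"] sm by (simp add: x algebra_simps)
      show "s * m \<le> near (2 * h) (x + y)"
        using sm m y by (intro ge[of "node a k + 1"]) (simp_all add: x algebra_simps flip: h_def)
    qed
    moreover have "s * m \<le> near (2 * h) x"
      using sm m y by (intro ge[of "node a k"]) (simp_all add: x algebra_simps flip: h_def)
    ultimately show ?thesis by simp
  qed
  then show ?thesis by (simp add: offset_def h_def m_def x_def)
qed

lemma coord_depth_strand:
  assumes s: "0 \<le> s" "s \<le> 1 / 8" and y: "height k < y" "y < 2 * height k"
  shows "coord (strand a k (s, y)) = (2 / 3) ^ k * s"
    and "depth (strand a k (s, y)) = (1 - 4 * s) * min (y - height k) (2 * height k - y)"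
proof -
  have lev: "level y = k" using y by (intro level_eq) auto
  have m: "margin y = min (y - height k) (2 * height k - y)" by (simp add: margin_def lev)
  then have "0 < margin y" using y by simp
  have off: "offset k (strand a k (s, y)) = s * margin y"
    using assms by (simp add: offset_strand m)
  show "coord (strand a k (s, y)) = (2 / 3) ^ k * s"
    using \<open>0 < margin y\<close> by (simp add: coord_def lev off)
  have "0 \<le> (1 - 4 * s) * margin y" using s \<open>0 < margin y\<close> by simp
  moreover have "margin y - 4 * (s * margin y) = (1 - 4 * s) * margin y" by (simp add: algebra_simps)
  ultimately have "depth (strand a k (s, y)) = (1 - 4 * s) * margin y"
    unfolding depth_def snd_strand snd_conv lev off by simp
  then show "depth (strand a k (s, y)) = (1 - 4 * s) * min (y - height k) (2 * height k - y)"
    unfolding m .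
qed

lemma depth_strand_endpoint:
  assumes "y \<in> {height k, 2 * height k}"
  shows "depth (strand a k (s, y)) = 0"
proof -
  have "margin y = 0"
  proof (cases "y = height k")
    case True
    \<comment> \<open>Strips contain their upper edge only, so \<open>height k\<close> has level
      \<open>Suc k\<close>.\<close>
    have "level y = Suc k" using True height_Suc[of k] height_pos[of "Suc k"] by (intro level_eq) linarith+
    moreover have "height (Suc k) \<le> height k" using height_Suc[of k] height_pos[of "Suc k"] by linarith
    ultimately show ?thesis using True unfolding margin_def by (simp add: height_Suc)
  next
    case False
    then have y: "y = 2 * height k" using assms by simp
    then have "level y = k" by (intro level_eq) auto
    then show ?thesis unfolding margin_def by (simp add: y)
  qed
  then show ?thesis
    using depth_le_margin[of "strand a k (s, y)"] depth_nonneg[of "strand a k (s, y)"] by simp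
qed

text \<open>Inside the lens \<open>coord\<close> is constant and the depth has slope at most
  \<open>1 - 4 * s\<close>, while the horizontal speed is at most 2, which the metric
  halves.\<close>

lemma lens_dist_strand:
  assumes s: "0 \<le> s" "s \<le> 1 / 8" and y: "y \<in> {height k..2 * height k}" "z \<in> {height k..2 * height k}"
  shows "lens_dist (strand a k (s, y)) (strand a k (s, z)) \<le> \<bar>y - z\<bar>"
proof -
  define h where "h = height k"
  define m where "m t = min (t - h) (2 * h - t)" for t
  define b where "b = real_of_int (node a (Suc k) - 2 * node a k)"
  have b: "b \<in> {0, 1}" using node_Suc[of a k] by (auto simp: b_def)
  have dm: "\<bar>m y - m z\<bar> \<le> \<bar>y - z\<bar>" by (auto simp: m_def)
  have int: "h < t \<and> t < 2 * h" if "t \<in> {height k..2 * height k}" "t \<notin> {height k, 2 * height k}" for t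
    using that by (auto simp: h_def)
  have "cone_dist coord depth (strand a k (s, y)) (strand a k (s, z)) \<le> \<bar>y - z\<bar>"
  proof (cases "y \<in> {height k, 2 * height k} \<or> z \<in> {height k, 2 * height k}")
    \<comment> \<open>At a node \<open>coord\<close> is junk, so the other branch of the cone
      distance, the sum of the depths, is used.\<close>
    case True
    have "depth (strand a k (s, t)) \<le> m t" if "t \<in> {height k..2 * height k}" for t
    proof (cases "t \<in> {height k, 2 * height k}")
      case True
      then show ?thesis using that depth_strand_endpoint[OF True] by (auto simp: m_def h_def)
    next
      case False
      then have "0 < m t" and d: "depth (strand a k (s, t)) = (1 - 4 * s) * m t"
        using coord_depth_strand(2)[OF s, of k t a] int[OF that False] by (auto simp: m_def h_def)
      moreover have "(1 - 4 * s) * m t \<le> 1 * m t" using s \<open>0 < m t\<close> by (intro mult_right_mono) auto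
      ultimately show ?thesis by simp
    qed
    from this[OF y(1)] this[OF y(2)]
    have "depth (strand a k (s, y)) + depth (strand a k (s, z)) \<le> \<bar>y - z\<bar>"
      using True depth_strand_endpoint[of y k a s] depth_strand_endpoint[of z k a s] y
      unfolding m_def h_def by auto
    then show ?thesis by (simp add: cone_dist_def)
  next
    case False
    then have "coord (strand a k (s, y)) = coord (strand a k (s, z))"
      and d: "depth (strand a k (s, y)) = (1 - 4 * s) * m y" "depth (strand a k (s, z)) = (1 - 4 * s) * m z"
      using coord_depth_strand[OF s, of k y a] coord_depth_strand[OF s, of k z a]
        int[OF y(1)] int[OF y(2)] by (auto simp: m_def h_def)
    moreover have "\<bar>(1 - 4 * s) * m y - (1 - 4 * s) * m z\<bar> = (1 - 4 * s) * \<bar>m y - m z\<bar>"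
      using s by (simp add: abs_mult flip: right_diff_distrib)
    moreover have "(1 - 4 * s) * \<bar>m y - m z\<bar> \<le> 1 * \<bar>y - z\<bar>"
      using s dm by (intro mult_mono) auto
    ultimately show ?thesis by (simp add: cone_dist_def)
  qed
  moreover have "\<bar>fst (strand a k (s, y)) - fst (strand a k (s, z))\<bar> \<le> 2 * \<bar>y - z\<bar>"
  proof -
    have "fst (strand a k (s, y)) - fst (strand a k (s, z)) = b * (z - y) + s * (m y - m z)"
      by (simp add: strand_def b_def m_def h_def algebra_simps)
    also have "\<bar>\<dots>\<bar> \<le> \<bar>b * (z - y)\<bar> + \<bar>s * (m y - m z)\<bar>" by (rule abs_triangle_ineq)
    also have "\<bar>s * (m y - m z)\<bar> \<le> 1 * \<bar>y - z\<bar>"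
      unfolding abs_mult using s dm by (intro mult_mono) auto
    also have "\<bar>b * (z - y)\<bar> \<le> \<bar>y - z\<bar>" using b by auto
    finally show ?thesis by simp
  qed
  ultimately show ?thesis unfolding lens_dist_def pinched_dist_le_iff by simp
qed

section \<open>Threads as geodesics ending near the base line\<close>

lemma thread_eq_strand:
  assumes "y \<in> {height k..2 * height k}"
  shows "thread a s y = strand a k (s, y)"
proof (cases "y = height k")
  case True
  have "level y = Suc k" using True height_Suc[of k] height_pos[of "Suc k"] by (intro level_eq) linarith+
  \<comment> \<open>The margins vanish at the common height, and both strands pass through the node
    with index \<open>node a (Suc k)\<close>.\<close>
  moreover have "strand a (Suc k) (s, height k) = strand a k (s, height k)"
  proof -
    define H where "H = height (Suc k)"
    have "height k = 2 * H" "0 < H" by (simp_all add: H_def height_Suc)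
    then show ?thesis by (simp add: strand_def algebra_simps flip: H_def)
  qed
  ultimately show ?thesis by (simp add: thread_def True)
next
  case False
  then have "level y = k" using assms by (intro level_eq) auto
  then show ?thesis by (simp add: thread_def)
qed

lemma lens_dist_triangle: "lens_dist p r \<le> lens_dist p q + lens_dist q r"
  and lens_dist_commute: "lens_dist p q = lens_dist q p"
proof -
  interpret Metric_space UNIV lens_dist
    unfolding lens_dist_def by (rule Metric_space_pinched_dist) simp
  show "lens_dist p r \<le> lens_dist p q + lens_dist q r" by (rule triangle) auto
  show "lens_dist p q = lens_dist q p" by (rule commute)
qed

text \<open>Induction over the strips, splitting at the common node by the triangle
  inequality.\<close>

lemma lens_dist_thread_le:
  assumes s: "0 \<le> s" "s \<le> 1 / 8"
  shows "(1 / 2) ^ n \<le> u \<Longrightarrow> u \<le> v \<Longrightarrow> v \<le> 1 \<Longrightarrow> lens_dist (thread a s u) (thread a s v) \<le> v - u"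
proof (induction n arbitrary: u v)
  case 0
  then have "u = 1" "v = 1" by auto
  moreover have "1 \<in> {height 0..2 * height 0}" by (simp add: height_def)
  ultimately show ?case
    using lens_dist_strand[OF s, of 1 0 1 a] thread_eq_strand[of 1 0 a s] by simp
next
  case (Suc n)
  have *: "lens_dist (thread a s u) (thread a s v) \<le> v - u"
    if "(1 / 2) ^ Suc n \<le> u" "u \<le> v" "v \<le> (1 / 2) ^ n" for u v
  proof -
    have "u \<in> {height n..2 * height n}" "v \<in> {height n..2 * height n}"
      using that by (auto simp: height_def)
    then show ?thesis
      using lens_dist_strand[OF s, of u n v a] thread_eq_strand[of u n a s] thread_eq_strand[of v n a s] that
      by simp
  qed
  consider "(1 / 2) ^ n \<le> u" | "v \<le> (1 / 2) ^ n" | "u \<le> (1 / 2) ^ n" "(1 / 2) ^ n \<le> v" by linarith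
  then show ?case
  proof cases
    case 3
    have "lens_dist (thread a s u) (thread a s v)
        \<le> lens_dist (thread a s u) (thread a s ((1 / 2) ^ n))
          + lens_dist (thread a s ((1 / 2) ^ n)) (thread a s v)"
      by (rule lens_dist_triangle)
    also have "\<dots> \<le> ((1 / 2) ^ n - u) + (v - (1 / 2) ^ n)"
      using 3 Suc.prems by (intro add_mono * Suc.IH) auto
    finally show ?thesis by simp
  qed (use Suc.prems Suc.IH * in auto)
qed

text \<open>The vertical term of the metric gives the lower bound, so a thread is a unit-speed
  geodesic parametrized by height.\<close>

lemma lens_dist_thread:
  assumes "0 \<le> s" "s \<le> 1 / 8" "u \<in> {(1 / 2) ^ n..1}" "v \<in> {(1 / 2) ^ n..1}"
  shows "lens_dist (thread a s u) (thread a s v) = \<bar>u - v\<bar>"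
proof (rule antisym)
  show "lens_dist (thread a s u) (thread a s v) \<le> \<bar>u - v\<bar>"
  proof (cases "u \<le> v")
    case True
    then show ?thesis using lens_dist_thread_le[of s n u v a] assms by simp
  next
    case False
    then show ?thesis using lens_dist_thread_le[of s n v u a] assms by (simp add: lens_dist_commute)
  qed
  show "\<bar>u - v\<bar> \<le> lens_dist (thread a s u) (thread a s v)"
    using pinched_dist_ge(2)[of "thread a s u" "thread a s v" coord depth]
    by (simp add: lens_dist_def thread_def)
qed

lemma continuous_on_thread:
  assumes "0 \<le> s" "s \<le> 1 / 8"
  shows "continuous_on {(1 / 2) ^ n..1} (thread a s)"
proof (rule lipschitz_on_continuous_on)
  show "3-lipschitz_on {(1 / 2) ^ n..1} (thread a s)"
  proof (rule lipschitz_onI)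
    fix u v :: real assume uv: "u \<in> {(1 / 2) ^ n..1}" "v \<in> {(1 / 2) ^ n..1}"
    let ?p = "thread a s u" and ?q = "thread a s v"
    have "dist ?p ?q \<le> \<bar>fst ?p - fst ?q\<bar> + \<bar>snd ?p - snd ?q\<bar>"
      by (simp add: dist_prod_def dist_real_def sqrt_sum_squares_le_sum_abs)
    also have "\<dots> \<le> 3 * lens_dist ?p ?q"
      using pinched_dist_ge(1,2)[of ?p ?q coord depth] unfolding lens_dist_def by linarith
    also have "\<dots> = 3 * dist u v" using lens_dist_thread[OF assms uv] by (simp add: dist_real_def)
    finally show "dist ?p ?q \<le> 3 * dist u v" .
  qed simp
qed

text \<open>No \<open>s\<close> on the right: all threads of a branch meet at its nodes.\<close>

lemma thread_node: "thread a s ((1 / 2) ^ n) = (of_int (node a n) * (1 / 2) ^ n, (1 / 2) ^ n)"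
proof -
  have "(1 / 2) ^ n \<in> {height n..2 * height n}" by (simp add: height_def)
  then have "thread a s ((1 / 2) ^ n) = strand a n (s, (1 / 2) ^ n)" by (rule thread_eq_strand)
  also have "\<dots> = (of_int (node a n) * (1 / 2) ^ n, (1 / 2) ^ n)"
    by (simp add: strand_def two_height) (simp add: height_def)
  finally show ?thesis .
qed

text \<open>Both points have depth 0, so only the plane terms count, and rounding down in
  \<open>node\<close> errs by at most \<open>(1 / 2) ^ n\<close>.\<close>

lemma lens_dist_thread_node: "lens_dist (a, 0) (thread a s ((1 / 2) ^ n)) \<le> (1 / 2) ^ n"
proof -
  have "depth (thread a s ((1 / 2) ^ n)) = 0"
    using depth_strand_endpoint[of "(1 / 2) ^ n" n a s] thread_eq_strand[of "(1 / 2) ^ n" n a s]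
    by (simp add: two_height) (simp add: height_def)
  \<comment> \<open>\<open>level 0\<close> is an arbitrary number, but positive depth would make
    \<open>height (level 0)\<close> negative.\<close>
  moreover have "depth (a, 0) = 0"
  proof (rule ccontr)
    assume "depth (a, 0) \<noteq> 0"
    then have "height (level 0) < 0" using depth_posD(3)[of "(a, 0)"] by (simp add: less_le)
    then show False using height_pos[of "level 0"] by linarith
  qed
  ultimately have "cone_dist coord depth (a, 0) (thread a s ((1 / 2) ^ n)) \<le> 0"
    by (simp add: cone_dist_def)
  moreover have "\<bar>a - of_int (node a n) * (1 / 2) ^ n\<bar> \<le> (1 / 2) ^ n"
  proof -
    have "\<bar>a * 2 ^ n - of_int (node a n)\<bar> \<le> 1" unfolding node_def by linarith
    then have "\<bar>a * 2 ^ n - of_int (node a n)\<bar> * (1 / 2) ^ n \<le> 1 * (1 / 2) ^ n"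
      by (rule mult_right_mono) simp
    moreover have "\<bar>a * 2 ^ n - of_int (node a n)\<bar> * (1 / 2) ^ n = \<bar>a - of_int (node a n) * (1 / 2) ^ n\<bar>"
      by (subst abs_mult_pos) (simp_all add: algebra_simps power_one_over)
    ultimately show ?thesis by simp
  qed
  ultimately show ?thesis
    unfolding lens_dist_def pinched_dist_le_iff thread_node
    by (auto intro: order_trans[OF _ zero_le_power])
qed

section \<open>Lower bound for the modulus\<close>

text \<open>Parameters of the strands: relative offset and height. The bound \<open>1 / 8\<close> is
  half of the value at which strands reach the boundary of the lens.\<close>

definition block :: "nat \<Rightarrow> (real \<times> real) set" where
  "block k = {0<..<1 / 8} \<times> {height k<..<2 * height k}"

section \<open>Area distortion of the strands\<close>

lemma open_block: "open (block k)"
  unfolding block_def by (intro open_Times open_greaterThanLessThan)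

lemma measurable_block [measurable]: "block k \<in> sets borel"
  using open_block by (rule borel_open)

lemma measurable_strand [measurable]: "strand a k \<in> borel_measurable borel"
  by (intro borel_measurable_continuous_onI continuous_on_strand)

lemma measurable_depth [measurable]: "depth \<in> borel_measurable borel"
  by (intro borel_measurable_continuous_onI continuous_on_depth)

text \<open>The sum of the depths exceeds \<open>\<eta>\<close>, so at smaller scales the cone
  distance cannot take the detour and bounds the difference in \<open>coord\<close>.\<close>

lemma strand_close:
  assumes "p \<in> block k" "q \<in> block k" "0 < \<eta>"
    and "\<eta> < depth (strand a k p)" "\<eta> < depth (strand a k q)"
    and d: "lens_dist (strand a k p) (strand a k q) \<le> r" "r \<le> \<eta>"
  shows "(2 / 3) ^ k * \<bar>fst p - fst q\<bar> \<le> r" "\<bar>snd p - snd q\<bar> \<le> r"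
proof -
  have c: "coord (strand a k v) = (2 / 3) ^ k * fst v" if "v \<in> block k" for v
    using that coord_depth_strand(1)[of "fst v" k "snd v" a] by (auto simp: block_def)
  have "\<bar>coord (strand a k p) - coord (strand a k q)\<bar> \<le> r"
    using d assms(3-5) by (auto simp: lens_dist_def pinched_dist_le_iff cone_dist_def min_le_iff_disj)
  then show "(2 / 3) ^ k * \<bar>fst p - fst q\<bar> \<le> r"
    using c assms(1,2) by (simp add: abs_mult flip: right_diff_distrib)
  show "\<bar>snd p - snd q\<bar> \<le> r"
    using d(1) by (simp add: lens_dist_def pinched_dist_le_iff)
qed

lemma emeasure_lborel_box:
  fixes x y c d :: real
  assumes "0 \<le> c" "0 \<le> d"
  shows "emeasure lborel ({x - c..x + c} \<times> {y - d..y + d}) = ennreal (4 * c * d)"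
proof -
  have "emeasure lborel ({x - c..x + c} \<times> {y - d..y + d}) =
      emeasure lborel {x - c..x + c} * emeasure lborel {y - d..y + d}"
    unfolding lborel_prod[symmetric] by (rule lborel.emeasure_pair_measure_Times) auto
  also have "\<dots> = ennreal (2 * c) * ennreal (2 * d)" using assms by simp
  also have "\<dots> = ennreal (4 * c * d)" using assms by (simp add: ac_simps flip: ennreal_mult)
  finally show ?thesis .
qed

text \<open>A covering set of diameter \<open>r\<close> pulls back into a box with half sides
  \<open>r / (2 / 3) ^ k\<close> and \<open>r\<close>. The factor is the ratio of
  \<open>pi / 4 * r\<^sup>2\<close> to the area of this box.\<close>

lemma hausdorff2_pre_strand:
  assumes "0 < \<eta>"
  shows "ennreal (pi / 16 * (2 / 3) ^ k)
      * emeasure lborel {p \<in> block k. \<eta> < depth (strand a k p) \<and> strand a k p \<in> A}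
    \<le> hausdorff2_pre lens_plane \<eta> A"
  unfolding hausdorff2_pre_def
proof (rule INF_greatest, clarify)
  define C where "C = {p \<in> block k. \<eta> < depth (strand a k p) \<and> strand a k p \<in> A}"
  let ?N = "(2 / 3) ^ k :: real"
  fix B :: "nat \<Rightarrow> (real \<times> real) set"
  assume cov: "A \<subseteq> (\<Union>i. B i)"
    and B: "\<forall>i. B i \<subseteq> mspace lens_plane \<and> ediam lens_plane (B i) \<le> ennreal \<eta>"
  define r where "r i = enn2real (ediam lens_plane (B i))" for i
  have fin: "ediam lens_plane (B i) < top" for i
    using B by (meson ennreal_less_top le_less_trans)
  have r: "ediam lens_plane (B i) = ennreal (r i)" "0 \<le> r i" "r i \<le> \<eta>" for i
  proof -
    show *: "ediam lens_plane (B i) = ennreal (r i)" using fin[of i] by (simp add: r_def)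
    show "0 \<le> r i" by (simp add: r_def)
    show "r i \<le> \<eta>" using B * \<open>0 < \<eta>\<close> by (metis ennreal_le_iff less_imp_le)
  qed
  define c where "c i = (SOME p. p \<in> C \<and> strand a k p \<in> B i)" for i
  define box where "box i = {fst (c i) - r i / ?N..fst (c i) + r i / ?N} \<times> {snd (c i) - r i..snd (c i) + r i}"
    for i
  have "C \<subseteq> (\<Union>i. box i)"
  proof
    fix p assume p: "p \<in> C"
    then obtain i where i: "strand a k p \<in> B i" using cov by (auto simp: C_def)
    have "\<exists>p. p \<in> C \<and> strand a k p \<in> B i" using p i by blast
    then have c: "c i \<in> C" "strand a k (c i) \<in> B i" unfolding c_def by (metis (mono_tags, lifting) someI_ex)+
    have "ennreal (lens_dist (strand a k p) (strand a k (c i))) \<le> ennreal (r i)"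
      using ediam_upper[OF i c(2), of lens_plane] by (simp add: r(1))
    then have "lens_dist (strand a k p) (strand a k (c i)) \<le> r i"
      using r(2) by (simp add: ennreal_le_iff)
    then have "?N * \<bar>fst p - fst (c i)\<bar> \<le> r i" "\<bar>snd p - snd (c i)\<bar> \<le> r i"
      using p c \<open>0 < \<eta>\<close> r(3)[of i] strand_close[of p k "c i" \<eta> a "r i"] by (auto simp: C_def)
    moreover from this(1) have "\<bar>fst p - fst (c i)\<bar> \<le> r i / ?N"
      by (simp add: pos_le_divide_eq mult.commute)
    ultimately have "p \<in> box i"
      unfolding box_def mem_Times_iff by (auto simp: abs_le_iff)
    then show "p \<in> (\<Union>i. box i)" by blast
  qed
  moreover have box: "box i \<in> sets lborel" for i
    unfolding box_def sets_lborel by (intro borel_closed closed_Times) auto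
  ultimately have "emeasure lborel C \<le> (\<Sum>i. emeasure lborel (box i))"
    by (intro order_trans[OF emeasure_mono emeasure_subadditive_countably]) auto
  then have "ennreal (pi / 16 * ?N) * emeasure lborel C
      \<le> ennreal (pi / 16 * ?N) * (\<Sum>i. emeasure lborel (box i))"
    by (rule mult_left_mono) simp
  also have "\<dots> = (\<Sum>i. ennreal (pi / 16 * ?N) * emeasure lborel (box i))" by simp
  also have "\<dots> = (\<Sum>i. ennreal (pi / 4) * (ediam lens_plane (B i))\<^sup>2)"
  proof (rule suminf_cong)
    fix i
    have "emeasure lborel (box i) = ennreal (4 * (r i / ?N) * r i)"
      unfolding box_def using r(2)[of i] by (intro emeasure_lborel_box) auto
    then show "ennreal (pi / 16 * ?N) * emeasure lborel (box i) = ennreal (pi / 4) * (ediam lens_plane (B i))\<^sup>2"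
      using r(2)[of i] by (simp add: r(1) ennreal_power power2_eq_square flip: ennreal_mult)
  qed
  finally show "ennreal (pi / 16 * ?N)
      * emeasure lborel {p \<in> block k. \<eta> < depth (strand a k p) \<and> strand a k p \<in> A}
      \<le> (\<Sum>i. ennreal (pi / 4) * (ediam lens_plane (B i))\<^sup>2)"
    unfolding C_def .
qed

text \<open>The depth is positive along the strands of a block, so the sets of depth above
  \<open>1 / Suc n\<close> exhaust it and monotone convergence applies.\<close>

lemma hausdorff2_outer_strand:
  assumes [measurable]: "A \<in> sets borel"
  shows "ennreal (pi / 16 * (2 / 3) ^ k) * emeasure lborel {p \<in> block k. strand a k p \<in> A}
      \<le> hausdorff2_outer lens_plane A"
proof -
  define C where
    "C n = {p \<in> block k. 1 / real (Suc n) < depth (strand a k p) \<and> strand a k p \<in> A}" for n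
  have C: "C n \<in> sets lborel" for n
    unfolding C_def by measurable
  have "incseq C"
  proof (rule incseq_SucI)
    show "C n \<le> C (Suc n)" for n
      using frac_le[of 1 1 "real (Suc n)" "real (Suc (Suc n))"] by (auto simp: C_def)
  qed
  have "{p \<in> block k. strand a k p \<in> A} = (\<Union>n. C n)"
  proof -
    have "\<exists>n. 1 / real (Suc n) < depth (strand a k p)" if "p \<in> block k" for p
    proof (rule nat_approx_posE)
      obtain s y where p: "p = (s, y)" by (cases p)
      then have "0 < s" "s < 1 / 8" "height k < y" "y < 2 * height k" using that by (auto simp: block_def)
      then show "0 < depth (strand a k p)" by (simp add: p coord_depth_strand(2))
    qed blast
    then show ?thesis by (auto simp: C_def)
  qed
  then have "emeasure lborel {p \<in> block k. strand a k p \<in> A} = (SUP n. emeasure lborel (C n))"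
    using SUP_emeasure_incseq[OF _ \<open>incseq C\<close>] C by (simp add: image_subset_iff)
  then have "ennreal (pi / 16 * (2 / 3) ^ k) * emeasure lborel {p \<in> block k. strand a k p \<in> A}
      = (SUP n. ennreal (pi / 16 * (2 / 3) ^ k) * emeasure lborel (C n))"
    by (simp add: SUP_mult_left_ennreal)
  also have "\<dots> \<le> hausdorff2_outer lens_plane A"
  proof (rule SUP_least)
    fix n
    have "ennreal (pi / 16 * (2 / 3) ^ k) * emeasure lborel (C n)
        \<le> hausdorff2_pre lens_plane (1 / real (Suc n)) A"
      unfolding C_def by (rule hausdorff2_pre_strand) auto
    also have "\<dots> \<le> hausdorff2_outer lens_plane A"
      unfolding hausdorff2_outer_def by (rule SUP_upper) simp
    finally show "ennreal (pi / 16 * (2 / 3) ^ k) * emeasure lborel (C n) \<le> hausdorff2_outer lens_plane A" .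
  qed
  finally show ?thesis .
qed

text \<open>The bound on sets says that the Hausdorff measure dominates the image under
  \<open>strand a k\<close> of scaled Lebesgue measure on the block; integrals inherit this.\<close>

lemma nn_integral_strand:
  assumes [measurable]: "g \<in> borel_measurable borel"
  shows "ennreal (pi / 16 * (2 / 3) ^ k) * (\<integral>\<^sup>+ p\<in>block k. g (strand a k p) \<partial>lborel)
      \<le> (\<integral>\<^sup>+ x. g x \<partial>hausdorff2 lens_plane)"
proof -
  let ?c = "ennreal (pi / 16 * (2 / 3) ^ k)"
  define M where "M = distr (density lborel (\<lambda>p. ?c * indicator (block k) p)) borel (strand a k)"
  have sets: "sets M = sets (hausdorff2 lens_plane)"
    by (simp add: M_def sets_hausdorff2_lens_plane)
  have "M \<le> hausdorff2 lens_plane"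
    unfolding le_measure[OF sets]
  proof
    fix A assume "A \<in> sets M"
    then have A[measurable]: "A \<in> sets borel" by (simp add: M_def)
    have [measurable]: "strand a k -` A \<in> sets borel"
      using measurable_sets[OF measurable_strand A] by simp
    have "emeasure M A = (\<integral>\<^sup>+ p. ?c * indicator {p \<in> block k. strand a k p \<in> A} p \<partial>lborel)"
      unfolding M_def
      by (subst emeasure_distr, measurable, subst emeasure_density)
         (auto intro!: nn_integral_cong split: split_indicator)
    also have "\<dots> = ?c * emeasure lborel {p \<in> block k. strand a k p \<in> A}"
      by (subst nn_integral_cmult) (auto simp: nn_integral_indicator)
    also have "\<dots> \<le> emeasure (hausdorff2 lens_plane) A"
      using hausdorff2_outer_strand[OF A] by (simp add: emeasure_hausdorff2 sets_hausdorff2_lens_plane)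
    finally show "emeasure M A \<le> emeasure (hausdorff2 lens_plane) A" .
  qed
  then have "(\<integral>\<^sup>+ x. g x \<partial>M) \<le> (\<integral>\<^sup>+ x. g x \<partial>hausdorff2 lens_plane)"
    by (rule nn_integral_mono_measure[OF sets])
  moreover have "(\<integral>\<^sup>+ x. g x \<partial>M) = (\<integral>\<^sup>+ p. ?c * (g (strand a k p) * indicator (block k) p) \<partial>lborel)"
    unfolding M_def
    by (subst nn_integral_distr, measurable, subst nn_integral_density)
       (auto intro!: nn_integral_cong simp: mult_ac)
  ultimately show ?thesis by (simp add: nn_integral_cmult)
qed

section \<open>Length-area estimate along the threads\<close>

lemma ennreal_le_square_plus:
  fixes x :: ennreal
  assumes "0 < c" shows "x \<le> ennreal c * x\<^sup>2 + ennreal (1 / c)"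
proof (cases x)
  case (real r)
  \<comment> \<open>The right side is twice \<open>(c * r)\<^sup>2 - c * r + 1\<close>.\<close>
  have "0 \<le> (c * r - 1)\<^sup>2 + c * r * (c * r) + 1" by simp
  then have "c * r \<le> c * (c * r\<^sup>2 + 1 / c)"
    using assms by (simp add: power2_eq_square algebra_simps)
  then have "r \<le> c * r\<^sup>2 + 1 / c" using assms by simp
  then have "ennreal r \<le> ennreal (c * r\<^sup>2 + 1 / c)" by (rule ennreal_leI)
  also have "\<dots> = ennreal c * (ennreal r)\<^sup>2 + ennreal (1 / c)"
    using assms real(1) by (simp add: ennreal_power ennreal_mult)
  finally show ?thesis by (simp add: real)
next
  case top
  then show ?thesis using assms by (simp add: ennreal_mult_top ennreal_eq_0_iff)
qed

lemma line_integral_thread_le: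
  assumes [measurable]: "\<rho> \<in> borel_measurable borel" and s: "0 \<le> s" "s \<le> 1 / 8"
  shows "line_integral lens_plane \<rho> ({(1 / 2) ^ n..1}, thread a s)
    \<le> (\<Sum>k<n. \<integral>\<^sup>+ t\<in>{height k<..<2 * height k}. \<rho> (strand a k (s, t)) \<partial>lborel)"
proof -
  let ?A = "(1 / 2) ^ n :: real"
  \<comment> \<open>Clamping the parameter extends the integrand to a Borel function on the
    line.\<close>
  define F where "F t = \<rho> (thread a s (max ?A (min 1 t)))" for t
  have "?A \<le> 1" by (simp add: power_le_one)
  have "continuous_on UNIV (thread a s \<circ> (\<lambda>t. max ?A (min 1 t)))"
    using \<open>?A \<le> 1\<close> by (intro continuous_on_compose continuous_intros
        continuous_on_subset[OF continuous_on_thread[OF s, of n]]) auto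
  then have "(\<lambda>t. thread a s (max ?A (min 1 t))) \<in> borel_measurable borel"
    by (intro borel_measurable_continuous_onI) (simp add: o_def)
  then have F: "F \<in> borel_measurable borel" unfolding F_def by simp
  have "line_integral lens_plane \<rho> ({?A..1}, thread a s) \<le> (\<integral>\<^sup>+ t\<in>{?A..1}. F t \<partial>lborel)"
  proof (rule line_integral_isometric_le[OF _ F])
    show "F t = \<rho> (thread a s t)" if "t \<in> {?A..1}" for t using that by (simp add: F_def)
  qed (use lens_dist_thread[OF s] in simp)
  also have "\<dots> \<le> (\<integral>\<^sup>+ t. (\<Sum>k<n. \<rho> (strand a k (s, t)) * indicator {height k<..<2 * height k} t) \<partial>lborel)"
  proof (rule nn_integral_mono_AE)
    \<comment> \<open>The open strips miss the heights of the nodes, a countable null set.\<close>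
    have "AE t in lborel. t \<notin> range (\<lambda>k::nat. (1 / 2 :: real) ^ k)"
      by (intro AE_not_in countable_imp_null_set_lborel) auto
    then show "AE t in lborel. F t * indicator {?A..1} t
        \<le> (\<Sum>k<n. \<rho> (strand a k (s, t)) * indicator {height k<..<2 * height k} t)"
    proof eventually_elim
      case (elim t)
      show ?case
      proof (cases "t \<in> {?A..1}")
        case True
        define k where "k = level t"
        have "0 < ?A" by simp
        then have "0 < t" "t \<le> 1" using True by (auto simp del: zero_less_power)
        then have t: "height k < t" "t \<le> (1 / 2) ^ k"
          using level_bounds[of t] by (simp_all add: k_def two_height)
        moreover have "t \<noteq> (1 / 2) ^ i" for i using elim by blast
        ultimately have "t < (1 / 2) ^ k" by (simp add: less_le)
        have "k < n"
        proof (rule ccontr)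
          assume "\<not> k < n"
          then have "(1 / 2 :: real) ^ k \<le> ?A" by (intro power_decreasing) auto
          moreover have "?A \<le> t" using True by simp
          ultimately show False using \<open>t < (1 / 2) ^ k\<close> by linarith
        qed
        have "F t * indicator {?A..1} t = \<rho> (strand a k (s, t)) * indicator {height k<..<2 * height k} t"
          using True t \<open>t < (1 / 2) ^ k\<close> by (simp add: F_def thread_def k_def two_height)
        also have "\<dots> \<le> (\<Sum>k<n. \<rho> (strand a k (s, t)) * indicator {height k<..<2 * height k} t)"
          using \<open>k < n\<close> by (intro member_le_sum) auto
        finally show ?thesis .
      qed simp
    qed
  qed
  also have "\<dots> = (\<Sum>k<n. \<integral>\<^sup>+ t\<in>{height k<..<2 * height k}. \<rho> (strand a k (s, t)) \<partial>lborel)"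
    by (rule nn_integral_sum) measurable
  finally show ?thesis .
qed

text \<open>Integrate the inequality for one thread over \<open>0 < s < 1 / 8\<close> and apply
  Tonelli.\<close>

lemma sum_blocks_ge:
  assumes [measurable]: "\<rho> \<in> borel_measurable borel"
    and ge: "\<And>s. 0 < s \<Longrightarrow> s < 1 / 8 \<Longrightarrow> 1 \<le> line_integral lens_plane \<rho> ({(1 / 2) ^ n..1}, thread a s)"
  shows "1 / 8 \<le> (\<Sum>k<n. \<integral>\<^sup>+ p\<in>block k. \<rho> (strand a k p) \<partial>lborel)"
proof -
  have meas: "(\<lambda>p. \<rho> (strand a k p) * indicator (block k) p) \<in> borel_measurable (lborel \<Otimes>\<^sub>M lborel)" for k
    by (simp add: lborel_prod)
  have "ennreal (1 / 8) = (\<integral>\<^sup>+ s. indicator {0<..<1 / 8::real} s \<partial>lborel)"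
    by (simp add: nn_integral_indicator)
  also have "\<dots> \<le> (\<integral>\<^sup>+ s. (\<Sum>k<n. \<integral>\<^sup>+ t. \<rho> (strand a k (s, t)) * indicator (block k) (s, t) \<partial>lborel) \<partial>lborel)"
  proof (rule nn_integral_mono)
    fix s :: real
    show "indicator {0<..<1 / 8} s
        \<le> (\<Sum>k<n. \<integral>\<^sup>+ t. \<rho> (strand a k (s, t)) * indicator (block k) (s, t) \<partial>lborel)"
    proof (cases "s \<in> {0<..<1 / 8}")
      case True
      then have "1 \<le> (\<Sum>k<n. \<integral>\<^sup>+ t\<in>{height k<..<2 * height k}. \<rho> (strand a k (s, t)) \<partial>lborel)"
        using ge[of s] line_integral_thread_le[of \<rho> s n a] by (auto intro: order_trans)
      then show ?thesis using True by (simp add: block_def indicator_times)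
    qed simp
  qed
  also have "\<dots> = (\<Sum>k<n. \<integral>\<^sup>+ s. \<integral>\<^sup>+ t. \<rho> (strand a k (s, t)) * indicator (block k) (s, t) \<partial>lborel \<partial>lborel)"
    by (rule nn_integral_sum) (rule lborel.borel_measurable_nn_integral_fst[OF meas])
  also have "\<dots> = (\<Sum>k<n. \<integral>\<^sup>+ p\<in>block k. \<rho> (strand a k p) \<partial>lborel)"
    by (subst lborel.nn_integral_fst) (simp_all add: lborel_prod)
  finally show ?thesis by (simp add: ennreal_divide_numeral flip: ennreal_1)
qed

text \<open>On level \<open>k\<close>, Young's inequality with weight \<open>4 * (2 / 3) ^ k\<close>
  leaves the error \<open>1 / 64 * (3 / 4) ^ k\<close>, the length over width of the lens up to a
  constant. These errors sum to at most \<open>1 / 16\<close>, half of the lower bound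
  \<open>1 / 8\<close> for the left side, whatever \<open>n\<close> is.\<close>

lemma nn_integral_blocks_le:
  assumes [measurable]: "\<rho> \<in> borel_measurable borel"
  shows "(\<Sum>k<n. \<integral>\<^sup>+ p\<in>block k. \<rho> (strand a k p) \<partial>lborel)
    \<le> ennreal (64 / pi) * (\<integral>\<^sup>+ x. (\<rho> x)\<^sup>2 \<partial>hausdorff2 lens_plane) + ennreal (1 / 16)"
proof -
  let ?H = "hausdorff2 lens_plane"
  define S where "S k = {p::real \<times> real. height k < snd p \<and> snd p < 2 * height k}" for k
  \<comment> \<open>The strips are disjoint, so the integrals of \<open>G k\<close> add up to at
    most that of \<open>\<rho>\<^sup>2\<close>.\<close>
  define G where "G k x = (\<rho> x)\<^sup>2 * indicator (S k) x" for k x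
  have [measurable]: "S k \<in> sets borel" for k
    unfolding S_def by (intro borel_open open_Collect_conj open_Collect_less continuous_intros)
  have G[measurable]: "G k \<in> borel_measurable borel" for k
    unfolding G_def by measurable
  have vol: "emeasure lborel (block k) = ennreal (height k / 8)" for k
  proof -
    have "emeasure lborel (block k) = emeasure lborel {0<..<1 / 8::real} * emeasure lborel {height k<..<2 * height k}"
      unfolding block_def lborel_prod[symmetric] by (rule lborel.emeasure_pair_measure_Times) auto
    then show ?thesis using height_pos[of k] by (simp flip: ennreal_mult)
  qed
  have "(\<integral>\<^sup>+ p\<in>block k. \<rho> (strand a k p) \<partial>lborel)
      \<le> ennreal (64 / pi) * (\<integral>\<^sup>+ x. G k x \<partial>?H) + ennreal (1 / 64 * (3 / 4) ^ k)" for k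
  proof -
    let ?N = "(2 / 3) ^ k :: real"
    have "(\<integral>\<^sup>+ p\<in>block k. \<rho> (strand a k p) \<partial>lborel)
        \<le> (\<integral>\<^sup>+ p. ennreal (4 * ?N) * (G k (strand a k p) * indicator (block k) p)
              + ennreal (1 / (4 * ?N)) * indicator (block k) p \<partial>lborel)"
    proof (rule nn_integral_mono)
      fix p
      show "\<rho> (strand a k p) * indicator (block k) p
          \<le> ennreal (4 * ?N) * (G k (strand a k p) * indicator (block k) p)
            + ennreal (1 / (4 * ?N)) * indicator (block k) p"
        using ennreal_le_square_plus[of "4 * ?N" "\<rho> (strand a k p)"]
        by (auto simp: G_def S_def block_def split: split_indicator)
    qed
    also have "\<dots> = ennreal (4 * ?N) * (\<integral>\<^sup>+ p\<in>block k. G k (strand a k p) \<partial>lborel)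
        + ennreal (1 / (4 * ?N)) * emeasure lborel (block k)"
      by (subst nn_integral_add) (auto simp: nn_integral_cmult nn_integral_cmult_indicator)
    also have "ennreal (1 / (4 * ?N)) * emeasure lborel (block k) = ennreal (1 / 64 * (3 / 4) ^ k)"
    proof -
      have eq: "1 / (4 * ?N) * (height k / 8) = 1 / 64 * (3 / 4) ^ k"
        by (simp add: height_def power_divide field_simps flip: power_mult_distrib)
      have "ennreal (1 / (4 * ?N)) * ennreal (height k / 8) = ennreal (1 / (4 * ?N) * (height k / 8))"
        by (intro ennreal_mult[symmetric]) (auto intro: less_imp_le)
      then show ?thesis unfolding vol eq .
    qed
    also have "ennreal (4 * ?N) * (\<integral>\<^sup>+ p\<in>block k. G k (strand a k p) \<partial>lborel)
        = ennreal (64 / pi) * (ennreal (pi / 16 * ?N) * (\<integral>\<^sup>+ p\<in>block k. G k (strand a k p) \<partial>lborel))"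
    proof -
      have "ennreal (4 * ?N) = ennreal (64 / pi) * ennreal (pi / 16 * ?N)"
        by (subst ennreal_mult[symmetric]) auto
      then show ?thesis by (simp only: mult.assoc)
    qed
    also have "\<dots> \<le> ennreal (64 / pi) * (\<integral>\<^sup>+ x. G k x \<partial>?H)"
      by (intro mult_left_mono nn_integral_strand G) simp
    finally show ?thesis by (simp add: add_right_mono)
  qed
  then have "(\<Sum>k<n. \<integral>\<^sup>+ p\<in>block k. \<rho> (strand a k p) \<partial>lborel)
      \<le> (\<Sum>k<n. ennreal (64 / pi) * (\<integral>\<^sup>+ x. G k x \<partial>?H) + ennreal (1 / 64 * (3 / 4) ^ k))"
    by (rule sum_mono)
  also have "\<dots> = ennreal (64 / pi) * (\<Sum>k<n. \<integral>\<^sup>+ x. G k x \<partial>?H) + ennreal (\<Sum>k<n. 1 / 64 * (3 / 4) ^ k)"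
    by (simp add: sum.distrib sum_distrib_left)
  also have "(\<Sum>k<n. \<integral>\<^sup>+ x. G k x \<partial>?H) \<le> (\<integral>\<^sup>+ x. (\<rho> x)\<^sup>2 \<partial>?H)"
  proof -
    have "(\<Sum>k<n. \<integral>\<^sup>+ x. G k x \<partial>?H) = (\<integral>\<^sup>+ x. (\<Sum>k<n. G k x) \<partial>?H)"
      using G by (subst nn_integral_sum) (simp_all cong: measurable_cong_sets add: sets_hausdorff2_lens_plane)
    also have "\<dots> \<le> (\<integral>\<^sup>+ x. (\<rho> x)\<^sup>2 \<partial>?H)"
    proof (rule nn_integral_mono)
      fix x
      have "(\<Sum>k<n. G k x) \<le> (\<Sum>k<n. if k = level (snd x) then (\<rho> x)\<^sup>2 else 0)"
        using level_eq by (intro sum_mono) (force simp: G_def S_def split: split_indicator)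
      also have "\<dots> \<le> (\<rho> x)\<^sup>2" by simp
      finally show "(\<Sum>k<n. G k x) \<le> (\<rho> x)\<^sup>2" .
    qed
    finally show ?thesis .
  qed
  also have "(\<Sum>k<n. 1 / 64 * (3 / 4) ^ k) \<le> (1 / 16 :: real)"
    by (simp add: geometric_sum flip: sum_distrib_left sum_divide_distrib)
  finally show ?thesis by (simp add: add_mono mult_left_mono ennreal_leI)
qed

text \<open>The threads from height \<open>(1 / 2) ^ n < r\<close> up to height 1 belong to the
  family. Hence \<open>1 / 8 \<le> 64 / pi * I + 1 / 16\<close> for the integral \<open>I\<close> of
  \<open>\<rho>\<^sup>2\<close>, with constants free of \<open>r\<close>.\<close>

lemma modulus_lens_plane_ge:
  assumes "0 < r"
  shows "ennreal (pi / 1024) \<le> modulus lens_plane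
    (curves_joining lens_plane (mcball_of lens_plane (a, 0) r)
       (mspace lens_plane - mball_of lens_plane (a, 0) 1) (mspace lens_plane))"
  unfolding modulus_def
proof (rule INF_greatest, clarify)
  fix \<rho>
  let ?\<Gamma> = "curves_joining lens_plane (mcball_of lens_plane (a, 0) r)
       (mspace lens_plane - mball_of lens_plane (a, 0) 1) (mspace lens_plane)"
  let ?I = "\<integral>\<^sup>+ x. (\<rho> x)\<^sup>2 \<partial>hausdorff2 lens_plane"
  assume adm: "admissible lens_plane ?\<Gamma> \<rho>"
  then have \<rho>: "\<rho> \<in> borel_measurable borel"
    by (simp add: admissible_def sets_hausdorff2_lens_plane cong: measurable_cong_sets)
  obtain n where n: "(1 / 2) ^ n < r" using real_arch_pow_inv[of r "1 / 2"] assms by auto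
  have "1 \<le> line_integral lens_plane \<rho> ({(1 / 2) ^ n..1}, thread a s)" if s: "0 < s" "s < 1 / 8" for s
  proof -
    have "thread a s ((1 / 2) ^ n) \<in> mcball_of lens_plane (a, 0) r"
      using lens_dist_thread_node[of a s n] n by simp
    moreover have "1 \<le> lens_dist (a, 0) (thread a s 1)"
      using pinched_dist_ge(2)[of "(a, 0)" "thread a s 1" coord depth] by (simp add: lens_dist_def thread_def)
    then have "thread a s 1 \<in> mspace lens_plane - mball_of lens_plane (a, 0) 1" by simp
    moreover have "is_curve lens_plane ({(1 / 2) ^ n..1}, thread a s)"
      using continuous_on_thread[of s n a] s by (simp add: is_curve_def is_interval_cc power_le_one)
    ultimately have "({(1 / 2) ^ n..1}, thread a s) \<in> ?\<Gamma>"
      unfolding curves_joining_def by (auto simp: power_le_one)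
    moreover have "locally_rectifiable lens_plane ({(1 / 2) ^ n..1}, thread a s)"
      using lens_dist_thread[of s _ n _ a] s by (intro locally_rectifiable_isometric) simp
    ultimately show ?thesis using adm by (auto simp: admissible_def)
  qed
  from sum_blocks_ge[OF \<rho> this] nn_integral_blocks_le[OF \<rho>, of a n]
  have *: "1 / 8 \<le> ennreal (64 / pi) * ?I + ennreal (1 / 16)" by (rule order_trans)
  show "ennreal (pi / 1024) \<le> ?I"
  proof (cases ?I)
    case (real i)
    have "1 / 8 = ennreal (1 / 8)" by (simp add: ennreal_divide_numeral flip: ennreal_1)
    moreover have "ennreal (64 / pi * i + 1 / 16) = ennreal (64 / pi) * ennreal i + ennreal (1 / 16)"
      using real(1) by (subst ennreal_plus, simp, simp, subst ennreal_mult) simp_all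
    ultimately have "ennreal (1 / 8) \<le> ennreal (64 / pi * i + 1 / 16)"
      using * real(2) by simp
    then have "1 / 8 \<le> 64 / pi * i + 1 / 16" using real by (subst (asm) ennreal_le_iff) auto
    then have "pi / 1024 \<le> i" by (simp add: field_simps)
    then show ?thesis unfolding real by (rule ennreal_leI)
  qed simp
qed

theorem proposition1p9:
  shows "\<exists>(X :: (real \<times> real) metric) E.
    metric_surface X \<and> locally_finite_hausdorff2 X \<and>
    E \<subseteq> mspace X \<and> nondegenerate_continuum X E \<and>
    (\<forall>a\<in>E. \<not> (\<forall>R>0.
       ((\<lambda>r. modulus X (curves_joining X (mcball_of X a r) (mspace X - mball_of X a R) (mspace X)))
          \<longlongrightarrow> 0) (at_right 0)))"
proof (intro exI conjI ballI notI)
  let ?E = "{0..1} \<times> {0} :: (real \<times> real) set"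
  show "metric_surface lens_plane"
    by (simp add: metric_surface_def euclidean_plane_two_manifold)
  show "locally_finite_hausdorff2 lens_plane" by (rule locally_finite_lens_plane)
  show "?E \<subseteq> mspace lens_plane" by simp
  have "compact ?E" "connected ?E" by (auto intro!: compact_Times connected_Times)
  moreover have "\<exists>x\<in>?E. \<exists>y\<in>?E. x \<noteq> y" by (rule bexI[of _ "(0, 0)"], rule bexI[of _ "(1, 0)"]) auto
  ultimately show "nondegenerate_continuum lens_plane ?E"
    by (simp add: nondegenerate_continuum_def)
  fix p assume "p \<in> ?E" and lim: "\<forall>R>0. ((\<lambda>r. modulus lens_plane (curves_joining lens_plane
      (mcball_of lens_plane p r) (mspace lens_plane - mball_of lens_plane p R) (mspace lens_plane)))
          \<longlongrightarrow> 0) (at_right 0)"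
  then obtain a where p: "p = (a, 0)" by auto
  \<comment> \<open>The lower bound for \<open>R = 1\<close> is uniform in \<open>r\<close> and
    passes to the limit.\<close>
  have "ennreal (pi / 1024) \<le> 0"
  proof (rule tendsto_lowerbound[OF lim[rule_format, of 1]])
    show "\<forall>\<^sub>F r in at_right 0. ennreal (pi / 1024) \<le> modulus lens_plane (curves_joining lens_plane
      (mcball_of lens_plane p r) (mspace lens_plane - mball_of lens_plane p 1) (mspace lens_plane))"
      using modulus_lens_plane_ge unfolding p by (auto intro: eventually_at_rightI[of 0 1])
  qed auto
  then show False using pi_gt_zero by (simp add: ennreal_eq_0_iff not_le)
qed

end
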